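(* Let $\Lambda\subset\mathbb{R}^d$ be a repetitive Meyer set and let $F:\Lambda\to\mathbb{R}^d$ be a generator of a shape deformation. If $F$ is not nonslip, then the deformed set $\Lambda^F=\{x+F(x):x\in\Lambda\}$ is not a Meyer set.
   Context: A Delone set in $\mathbb{R}^d$ is a uniformly discrete and relatively dense set; a Meyer set is a Delone set $\Lambda$ such that $\Lambda-\Lambda$ is uniformly discrete. A Delone set $\Lambda$ is repetitive if for every patch $\Lambda\cap B$ ($B$ compact) there is a radius such that every ball of that radius contains a translated copy of the patch in $\Lambda$; it has finite local complexity if for each $R>0$ the set $\{B_R(0)\cap(\Lambda-x):x\in\Lambda\}$ is finite. All Delone sets considered are repetitive and have finite local complexity. The hull $\Omega_\Lambda$ is the closure of the translation orbit of $\Lambda$ in a metric in which two Delone sets are close if they agree exactly on a large ball around the origin up to a small translation; $\mathbb{R}^d$ acts on it by translation. $\Xi_\Lambda$ is the closure of $\{\Lambda-x:x\in\Lambda\}$ in $\Omega_\Lambda$. $\pi_{max}:\Omega_\Lambda\to\Omega_{max}$ denotes the maximal equicontinuous factor map of $(\Omega_\Lambda,\mathbb{R}^d)$ (onto the largest factor on which the action is equicontinuous). For $F:\Lambda\to\mathbb{R}^d$ put $\delta F(x,y)=F(y)-F(x)$ for $x,y\in\Lambda$. $\delta F$ is strongly pattern equivariant if for some $R_0$, large enough that every ball of radius $R_0/3$ contains a point of $\Lambda$, there is $R>0$ such that $\delta F(x_1,y_1)=\delta F(x_2,y_2)$ whenever $|y_i-x_i|\le R_0$, $y_1-x_1=y_2-x_2$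 and $\Lambda-x_1$, $\Lambda-x_2$ agree exactly on $B_R(0)$. $F$ is a generator of a shape deformation, and $\Lambda^F$ is the corresponding deformation of $\Lambda$, if $\delta F$ is strongly pattern equivariant. $F$ is weakly pattern equivariant if there is a continuous $\tilde F:\Xi_\Lambda\to\mathbb{R}^d$ with $F(x)=\tilde F(\Lambda-x)$ for all $x\in\Lambda$. The property of being nonslip is defined for weakly pattern equivariant functions, so $F$ is understood to be weakly pattern equivariant: such an $F$ on a Meyer set $\Lambda$ is nonslip if there is $\epsilon>0$ such that for all $\Lambda_1,\Lambda_2\in\Xi_\Lambda$ with $\pi_{max}(\Lambda_1)=\pi_{max}(\Lambda_2)$ that agree out to radius $\epsilon^{-1}$ around the origin one has $\tilde F(\Lambda_1)=\tilde F(\Lambda_2)$. *)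

theory Defs
  imports "HOL-Analysis.Analysis"
begin

section \<open>Delone and Meyer sets\<close>

definition relatively_dense :: "'a::euclidean_space set \<Rightarrow> bool" where
  "relatively_dense S \<longleftrightarrow> (\<exists>R>0. \<forall>p. \<exists>x\<in>S. dist p x \<le> R)"

definition delone_set :: "'a::euclidean_space set \<Rightarrow> bool" where
  "delone_set S \<longleftrightarrow> uniform_discrete S \<and> relatively_dense S"

definition meyer_set :: "'a::euclidean_space set \<Rightarrow> bool" where
  "meyer_set S \<longleftrightarrow> delone_set S \<and> uniform_discrete {x - y | x y. x \<in> S \<and> y \<in> S}"

text \<open>\<open>shift v S\<close> is the translate \<open>S - v\<close>.\<close>

definition shift :: "'a::euclidean_space \<Rightarrow> 'a set \<Rightarrow> 'a set" where
  "shift v S = (\<lambda>y. y - v) ` S"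

text \<open>A copy of the patch \<open>S \<inter> B\<close> is an exact one: \<open>S\<close> has no further points in the translate of
  \<open>B\<close>, and it is this translate of \<open>B\<close> that has to lie in the given ball.\<close>

definition repetitive :: "'a::euclidean_space set \<Rightarrow> bool" where
  "repetitive S \<longleftrightarrow>
    (\<forall>B. compact B \<longrightarrow>
      (\<exists>R>0. \<forall>p. \<exists>t. (+) t ` B \<subseteq> cball p R \<and> S \<inter> (+) t ` B = (+) t ` (S \<inter> B)))"

definition finite_local_complexity :: "'a::euclidean_space set \<Rightarrow> bool" where
  "finite_local_complexity S \<longleftrightarrow> (\<forall>R>0. finite {cball 0 R \<inter> shift x S | x. x \<in> S})"

definition agree_on_ball :: "real \<Rightarrow> 'a::euclidean_space set \<Rightarrow> 'a set \<Rightarrow> bool" where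
  "agree_on_ball R S T \<longleftrightarrow> cball 0 R \<inter> S = cball 0 R \<inter> T"


section \<open>The hull\<close>

definition delone_close :: "real \<Rightarrow> 'a::euclidean_space set \<Rightarrow> 'a set \<Rightarrow> bool" where
  "delone_close e S T \<longleftrightarrow>
    (\<exists>u v. norm u \<le> e \<and> norm v \<le> e \<and> agree_on_ball (1 / e) (shift u S) (shift v T))"

text \<open>The usual metric on Delone sets. Truncation at \<open>1\<close> is what makes the triangle inequality hold.\<close>

definition delone_dist :: "'a::euclidean_space set \<Rightarrow> 'a set \<Rightarrow> real" where
  "delone_dist S T = Inf (insert 1 {e. 0 < e \<and> delone_close e S T})"

definition delone_metric :: "'a::euclidean_space set metric" where
  "delone_metric = metric (Collect delone_set, delone_dist)"

lemma mem_shift: "p \<in> shift v S \<longleftrightarrow> p + v \<in> S"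
  by (force simp: shift_def image_iff algebra_simps)

lemma shift_agreeD:
  assumes "cball 0 R \<inter> shift u A = cball 0 R \<inter> shift v B" "norm p \<le> R"
  shows "p + u \<in> A \<longleftrightarrow> p + v \<in> B"
proof -
  have "p \<in> cball 0 R \<inter> shift u A \<longleftrightarrow> p \<in> cball 0 R \<inter> shift v B" using assms(1) by simp
  then show ?thesis using assms(2) by (simp add: mem_shift)
qed

lemma delone_close_sym: "delone_close e S T \<Longrightarrow> delone_close e T S"
  unfolding delone_close_def agree_on_ball_def by metis

lemma delone_close_mono:
  assumes "delone_close e S T" "0 < e" "e \<le> e'"
  shows "delone_close e' S T"
proof -
  obtain u v where uv: "norm u \<le> e" "norm v \<le> e"
      "cball 0 (1/e) \<inter> shift u S = cball 0 (1/e) \<inter> shift v T"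
    using assms(1) unfolding delone_close_def agree_on_ball_def by blast
  have "1/e' \<le> 1/e" using assms by (simp add: frac_le)
  then have "cball 0 (1/e') \<subseteq> cball (0::'a) (1/e)" by (rule subset_cball)
  then have "cball 0 (1/e') \<inter> shift u S = cball 0 (1/e') \<inter> shift v T"
    using uv(3) by blast
  moreover have "norm u \<le> e'" "norm v \<le> e'" using uv(1,2) assms(3) by linarith+
  ultimately show ?thesis unfolding delone_close_def agree_on_ball_def by blast
qed

lemma delone_close_trans:
  assumes "delone_close a A B" "delone_close b B C" "0 < a" "0 < b" "a + b \<le> 1"
  shows "delone_close (a + b) A C"
proof -
  obtain x y where xy: "norm x \<le> a" "norm y \<le> a"
      "cball 0 (1/a) \<inter> shift x A = cball 0 (1/a) \<inter> shift y B"
    using assms(1) unfolding delone_close_def agree_on_ball_def by blast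
  obtain z w where zw: "norm z \<le> b" "norm w \<le> b"
      "cball 0 (1/b) \<inter> shift z B = cball 0 (1/b) \<inter> shift w C"
    using assms(2) unfolding delone_close_def agree_on_ball_def by blast
  have arith: "1/(s+t) + t \<le> 1/s" if "0 < s" "0 < t" "s + t \<le> 1" for s t :: real
  proof -
    have "s * (s + t) \<le> 1" using that by (simp add: mult_le_one)
    then have "t \<le> t / (s * (s + t))"
      using that mult_left_mono[of "s * (s + t)" 1 t] by (simp add: pos_le_divide_eq)
    moreover have "1/s - 1/(s+t) = t / (s * (s + t))" using that by (simp add: field_simps)
    ultimately show ?thesis by linarith
  qed
  have ar1: "1/(a+b) + b \<le> 1/a" using arith assms by blast
  have ar2: "1/(a+b) + a \<le> 1/b" using arith[of b a] assms by (simp add: add.commute)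
  have "p \<in> shift (x + z) A \<longleftrightarrow> p \<in> shift (y + w) C" if p: "norm p \<le> 1/(a+b)" for p
  proof -
    have "norm (p + z) \<le> 1/a" using norm_triangle_ineq[of p z] p zw(1) ar1 by linarith
    then have 1: "p + z + x \<in> A \<longleftrightarrow> p + z + y \<in> B"
      using shift_agreeD[OF xy(3), of "p + z"] by simp
    have "norm (p + y) \<le> 1/b" using norm_triangle_ineq[of p y] p xy(2) ar2 by linarith
    then have 2: "p + y + z \<in> B \<longleftrightarrow> p + y + w \<in> C"
      using shift_agreeD[OF zw(3), of "p + y"] by simp
    show ?thesis using 1 2 by (simp add: mem_shift ac_simps)
  qed
  then have "cball 0 (1/(a+b)) \<inter> shift (x+z) A = cball 0 (1/(a+b)) \<inter> shift (y+w) C"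
    by auto
  moreover have "norm (x+z) \<le> a + b" "norm (y+w) \<le> a + b"
    using xy zw norm_triangle_ineq[of x z] norm_triangle_ineq[of y w] by linarith+
  ultimately show ?thesis unfolding delone_close_def agree_on_ball_def by blast
qed

lemma delone_close_imp_subset:
  assumes "closed B" "\<And>e. 0 < e \<Longrightarrow> e < 1 \<Longrightarrow> delone_close e A B"
  shows "A \<subseteq> B"
proof
  fix p assume p: "p \<in> A"
  have "\<exists>q\<in>B. dist q p < d" if "d > 0" for d
  proof -
    define e where "e = min (d/4) (min (1/2) (1/(norm p + 1)))"
    have np: "0 < norm p + 1" by (simp add: add_nonneg_pos)
    have e: "0 < e" "e < 1" "e \<le> d/4" "e \<le> 1/(norm p + 1)"
      using that np by (auto simp: e_def)
    obtain u v where uv: "norm u \<le> e" "norm v \<le> e"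
        "cball 0 (1/e) \<inter> shift u A = cball 0 (1/e) \<inter> shift v B"
      using assms(2)[OF e(1,2)] unfolding delone_close_def agree_on_ball_def by blast
    have "norm p + 1 \<le> 1/e" using e np by (simp add: field_simps)
    then have "norm (p - u) \<le> 1/e" using norm_triangle_ineq4[of p u] uv(1) e(2) by linarith
    then have "p - u + v \<in> B" using shift_agreeD[OF uv(3), of "p - u"] p by simp
    moreover have "dist (p - u + v) p < d"
    proof -
      have "dist (p - u + v) p = norm (v - u)" by (simp add: dist_norm)
      then show ?thesis using norm_triangle_ineq4[of v u] uv e that by linarith
    qed
    ultimately show ?thesis by blast
  qed
  then show "p \<in> B" using assms(1) closure_approachable[of p B] by (simp add: closure_closed)
qed

lemma delone_dist_less:
  assumes "delone_dist S T < e" "e \<le> 1"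
  shows "0 < e" "delone_close e S T"
proof -
  obtain x where "x \<in> insert 1 {e. 0 < e \<and> delone_close e S T}" "x < e"
    using cInf_lessD[of "insert 1 {e. 0 < e \<and> delone_close e S T}" e] assms(1)
    unfolding delone_dist_def by blast
  then have x: "0 < x" "delone_close x S T" "x < e" using assms(2) by auto
  then show "0 < e" by linarith
  show "delone_close e S T" using x delone_close_mono[of x S T e] by simp
qed

lemma delone_dist_le: "0 < e \<Longrightarrow> delone_close e S T \<Longrightarrow> delone_dist S T \<le> e"
  unfolding delone_dist_def by (intro cInf_lower bdd_belowI[of _ 0]) auto

lemma delone_dist_le_1: "delone_dist S T \<le> 1"
  unfolding delone_dist_def by (intro cInf_lower bdd_belowI[of _ 0]) auto

lemma delone_dist_nonneg: "0 \<le> delone_dist S T"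
  unfolding delone_dist_def by (intro cInf_greatest) auto

lemma Metric_space_delone: "Metric_space (Collect delone_set) delone_dist"
proof
  fix A B C :: "'a set"
  show "0 \<le> delone_dist A B" by (rule delone_dist_nonneg)
  have "delone_close e A B = delone_close e B A" for e
    by (rule iffI) (rule delone_close_sym, assumption)+
  then show "delone_dist A B = delone_dist B A" by (simp only: delone_dist_def)
  show "delone_dist A C \<le> delone_dist A B + delone_dist B C"
  proof (rule field_le_epsilon)
    fix k :: real assume k: "0 < k"
    define a where "a = delone_dist A B + k/2"
    define b where "b = delone_dist B C + k/2"
    have pos: "0 < a" "0 < b" using k delone_dist_nonneg[of A B] delone_dist_nonneg[of B C]
      by (auto simp: a_def b_def)
    have "delone_dist A C \<le> a + b"
    proof (cases "a + b \<le> 1")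
      case True
      then have "delone_close a A B" "delone_close b B C"
        using delone_dist_less[of A B a] delone_dist_less[of B C b] k pos
        by (auto simp: a_def b_def)
      then show ?thesis using delone_close_trans pos True delone_dist_le
        by (metis add_pos_pos)
    next
      case False then show ?thesis using delone_dist_le_1[of A C] by linarith
    qed
    then show "delone_dist A C \<le> delone_dist A B + delone_dist B C + k"
      by (simp add: a_def b_def)
  qed
  assume "A \<in> Collect delone_set" "B \<in> Collect delone_set"
  then have cl: "closed A" "closed B"
    by (auto simp: delone_set_def uniform_discrete_imp_closed)
  show "delone_dist A B = 0 \<longleftrightarrow> A = B"
  proof
    assume "delone_dist A B = 0"
    then have *: "delone_close e A B" if "0 < e" "e < 1" for e
      using delone_dist_less[of A B e] that by simp
    show "A = B"
    proof (rule subset_antisym)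
      show "A \<subseteq> B" using * by (rule delone_close_imp_subset[OF cl(2)])
      show "B \<subseteq> A" using *[THEN delone_close_sym] by (rule delone_close_imp_subset[OF cl(1)])
    qed
  next
    assume "A = B"
    have "delone_dist A B \<le> e" if "0 < e" for e
    proof (rule delone_dist_le[OF that])
      have "norm (0::'a) \<le> e" using that by simp
      then show "delone_close e A B"
        using \<open>A = B\<close> unfolding delone_close_def agree_on_ball_def by blast
    qed
    then have "delone_dist A B \<le> 0" using field_le_epsilon[of "delone_dist A B" 0] by simp
    then show "delone_dist A B = 0" using delone_dist_nonneg[of A B] by linarith
  qed
qed

definition delone_hull :: "'a::euclidean_space set \<Rightarrow> 'a set set" where
  "delone_hull S = mtopology_of delone_metric closure_of (range (\<lambda>v. shift v S))"

definition hull_topology :: "'a::euclidean_space set \<Rightarrow> 'a set topology" where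
  "hull_topology S = subtopology (mtopology_of delone_metric) (delone_hull S)"

text \<open>The canonical transversal of the hull.\<close>

definition Xi :: "'a::euclidean_space set \<Rightarrow> 'a set set" where
  "Xi S = hull_topology S closure_of ((\<lambda>x. shift x S) ` S)"


section \<open>The maximal equicontinuous factor\<close>

text \<open>A factor of the compact metrizable space \<open>delone_hull S\<close> is compact Hausdorff, hence
  metrizable, and equicontinuity of an action on a compact metrizable space does not depend on the metric.
  So it is enough to consider metric factors.\<close>

definition flow_on :: "'y metric \<Rightarrow> ('a::euclidean_space \<Rightarrow> 'y \<Rightarrow> 'y) \<Rightarrow> bool" where
  "flow_on Y act \<longleftrightarrow>
    continuous_map (prod_topology euclidean (mtopology_of Y)) (mtopology_of Y) (\<lambda>(v, y). act v y) \<and>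
    (\<forall>y\<in>mspace Y. act 0 y = y) \<and>
    (\<forall>u v. \<forall>y\<in>mspace Y. act (u + v) y = act u (act v y))"

definition equicontinuous_action :: "'y metric \<Rightarrow> ('a::euclidean_space \<Rightarrow> 'y \<Rightarrow> 'y) \<Rightarrow> bool" where
  "equicontinuous_action Y act \<longleftrightarrow>
    (\<forall>e>0. \<exists>d>0. \<forall>x\<in>mspace Y. \<forall>y\<in>mspace Y. mdist Y x y < d \<longrightarrow>
       (\<forall>v. mdist Y (act v x) (act v y) < e))"

definition equicontinuous_factor ::
  "'a::euclidean_space set \<Rightarrow> 'y metric \<Rightarrow> ('a \<Rightarrow> 'y \<Rightarrow> 'y) \<Rightarrow> ('a set \<Rightarrow> 'y) \<Rightarrow> bool" where
  "equicontinuous_factor S Y act \<pi> \<longleftrightarrow>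
    compact_space (mtopology_of Y) \<and> flow_on Y act \<and> equicontinuous_action Y act \<and>
    continuous_map (hull_topology S) (mtopology_of Y) \<pi> \<and> \<pi> ` delone_hull S = mspace Y \<and>
    (\<forall>v. \<forall>T\<in>delone_hull S. \<pi> (shift v T) = act v (\<pi> T))"

text \<open>The universal property. HOL cannot quantify over types inside a definition, so the competing
  factors \<open>Z\<close> have points of type \<^typ>\<open>'a set set\<close>. Nothing is lost by this: the points of a factor
  correspond to their fibres in the hull, see \<open>maximal_equicontinuous_factor_universal\<close> below.\<close>

definition maximal_equicontinuous_factor ::
  "'a::euclidean_space set \<Rightarrow> 'y metric \<Rightarrow> ('a \<Rightarrow> 'y \<Rightarrow> 'y) \<Rightarrow> ('a set \<Rightarrow> 'y) \<Rightarrow> bool" where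
  "maximal_equicontinuous_factor S Y act \<pi> \<longleftrightarrow>
    equicontinuous_factor S Y act \<pi> \<and>
    (\<forall>(Z :: 'a set set metric) actZ \<rho>. equicontinuous_factor S Z actZ \<rho> \<longrightarrow>
      (\<exists>h. continuous_map (mtopology_of Y) (mtopology_of Z) h \<and>
           (\<forall>v. \<forall>y\<in>mspace Y. h (act v y) = actZ v (h y)) \<and>
           (\<forall>T\<in>delone_hull S. \<rho> T = h (\<pi> T))))"

lemma isometry_continuous_map:
  assumes "f ` mspace m1 \<subseteq> mspace m2"
    and "\<And>x y. x \<in> mspace m1 \<Longrightarrow> y \<in> mspace m1 \<Longrightarrow> mdist m2 (f x) (f y) = mdist m1 x y"
  shows "continuous_map (mtopology_of m1) (mtopology_of m2) f"
  unfolding mtopology_of_def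
  by (subst Metric_space.metric_continuous_map) (use assms in auto)

lemma maximal_equicontinuous_factor_universal:
  fixes S :: "'a::euclidean_space set" and Z :: "'z metric"
  assumes max: "maximal_equicontinuous_factor S Y act \<pi>"
    and Z: "equicontinuous_factor S Z actZ \<rho>"
  obtains h where "continuous_map (mtopology_of Y) (mtopology_of Z) h"
    and "\<And>v y. y \<in> mspace Y \<Longrightarrow> h (act v y) = actZ v (h y)"
    and "\<And>T. T \<in> delone_hull S \<Longrightarrow> \<rho> T = h (\<pi> T)"
proof -
  define j where "j z = {T \<in> delone_hull S. \<rho> T = z}" for z
  define k where "k = inv_into (mspace Z) j"
  define W where "W = metric (j ` mspace Z, \<lambda>A B. mdist Z (k A) (k B))"
  have surj: "\<rho> ` delone_hull S = mspace Z" and fl: "flow_on Z actZ" and eq: "equicontinuous_action Z actZ"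
    and comp: "compact_space (mtopology_of Z)"
    and cont: "continuous_map (hull_topology S) (mtopology_of Z) \<rho>"
    and equi: "\<And>v T. T \<in> delone_hull S \<Longrightarrow> \<rho> (shift v T) = actZ v (\<rho> T)"
    using Z by (auto simp: equicontinuous_factor_def)
  have inj: "inj_on j (mspace Z)"
  proof (rule inj_onI)
    fix x y assume xy: "x \<in> mspace Z" "y \<in> mspace Z" "j x = j y"
    then obtain T where "T \<in> delone_hull S" "\<rho> T = x" using surj by (metis imageE)
    then have "T \<in> j y" using xy(3) by (auto simp: j_def)
    then show "x = y" using \<open>\<rho> T = x\<close> by (simp add: j_def)
  qed
  then have kj: "k (j z) = z" if "z \<in> mspace Z" for z using that by (simp add: k_def)
  have MS: "Metric_space (j ` mspace Z) (\<lambda>A B. mdist Z (k A) (k B))"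
    by unfold_locales (auto simp: kj mdist_triangle mdist_commute dest: inj_onD[OF inj])
  have [simp]: "mspace W = j ` mspace Z" "mdist W = (\<lambda>A B. mdist Z (k A) (k B))"
    using MS by (simp_all add: W_def Metric_space.mspace_metric Metric_space.mdist_metric)
  have cj: "continuous_map (mtopology_of Z) (mtopology_of W) j"
    by (rule isometry_continuous_map) (auto simp: kj)
  have ck: "continuous_map (mtopology_of W) (mtopology_of Z) k"
    by (rule isometry_continuous_map) (auto simp: kj)
  have act_in: "actZ v z \<in> mspace Z" if "z \<in> mspace Z" for v z
    using fl that by (force simp: flow_on_def continuous_map_def)
  define actW where "actW v A = j (actZ v (k A))" for v A
  have "equicontinuous_factor S W actW (j \<circ> \<rho>)"
    unfolding equicontinuous_factor_def
  proof (intro conjI)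
    show "compact_space (mtopology_of W)"
    proof -
      have "compactin (mtopology_of W) (j ` mspace Z)"
        using image_compactin[OF _ cj] comp by (simp add: compact_space_def)
      then show ?thesis by (simp add: compact_space_def)
    qed
    show "flow_on W actW"
      unfolding flow_on_def
    proof (intro conjI)
      have "continuous_map (prod_topology euclidean (mtopology_of W))
              (prod_topology euclidean (mtopology_of Z)) (\<lambda>p. (fst p, k (snd p)))"
        by (intro continuous_map_pairedI continuous_map_fst
             continuous_map_compose[OF continuous_map_snd ck, unfolded comp_def])
      moreover have "continuous_map (prod_topology euclidean (mtopology_of Z))
            (mtopology_of Z) (\<lambda>(v, z). actZ v z)" using fl by (simp add: flow_on_def)
      ultimately have "continuous_map (prod_topology euclidean (mtopology_of W)) (mtopology_of W)
            (j \<circ> ((\<lambda>(v, z). actZ v z) \<circ> (\<lambda>p. (fst p, k (snd p)))))"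
        by (intro continuous_map_compose[OF _ cj] continuous_map_compose)
      then show "continuous_map (prod_topology euclidean (mtopology_of W)) (mtopology_of W)
            (\<lambda>(v, y). actW v y)"
        by (simp add: actW_def comp_def case_prod_unfold)
    qed (use fl in \<open>auto simp: actW_def flow_on_def kj act_in\<close>)
    show "equicontinuous_action W actW"
      using eq by (simp add: equicontinuous_action_def actW_def kj act_in)
    show "continuous_map (hull_topology S) (mtopology_of W) (j \<circ> \<rho>)"
      by (rule continuous_map_compose[OF cont cj])
    show "(j \<circ> \<rho>) ` delone_hull S = mspace W" using surj by (simp only: image_comp[symmetric] \<open>mspace W = j ` mspace Z\<close>)
    show "\<forall>v. \<forall>T\<in>delone_hull S. (j \<circ> \<rho>) (shift v T) = actW v ((j \<circ> \<rho>) T)"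
    proof (intro allI ballI)
      fix v T assume T: "T \<in> delone_hull S"
      then have "\<rho> T \<in> mspace Z" using surj by blast
      then show "(j \<circ> \<rho>) (shift v T) = actW v ((j \<circ> \<rho>) T)"
        by (simp add: actW_def equi[OF T] kj)
    qed
  qed
  then obtain h where h: "continuous_map (mtopology_of Y) (mtopology_of W) h"
      "\<And>v y. y \<in> mspace Y \<Longrightarrow> h (act v y) = actW v (h y)"
      "\<And>T. T \<in> delone_hull S \<Longrightarrow> (j \<circ> \<rho>) T = h (\<pi> T)"
    using max unfolding maximal_equicontinuous_factor_def by metis
  show thesis
  proof (rule that[of "k \<circ> h"])
    show "continuous_map (mtopology_of Y) (mtopology_of Z) (k \<circ> h)"
      by (rule continuous_map_compose[OF h(1) ck])
    show "(k \<circ> h) (act v y) = actZ v ((k \<circ> h) y)" if "y \<in> mspace Y" for v y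
    proof -
      have "h y \<in> mspace W"
        using continuous_map_image_subset_topspace[OF h(1)] that by auto
      then obtain z where "z \<in> mspace Z" "h y = j z" by auto
      then show ?thesis using h(2)[OF that] by (simp add: actW_def kj act_in)
    qed
    show "\<rho> T = (k \<circ> h) (\<pi> T)" if "T \<in> delone_hull S" for T
      using h(3)[OF that] kj surj that by (metis comp_apply imageI)
  qed
qed


section \<open>Pattern equivariance and shape deformations\<close>

text \<open>Functions on \<open>S\<close> are total functions of which only the values on \<open>S\<close> matter.\<close>

definition coboundary :: "('a::euclidean_space \<Rightarrow> 'a) \<Rightarrow> 'a \<Rightarrow> 'a \<Rightarrow> 'a" where
  "coboundary F x y = F y - F x"

definition strongly_pattern_equivariant ::
  "'a::euclidean_space set \<Rightarrow> ('a \<Rightarrow> 'a \<Rightarrow> 'a) \<Rightarrow> bool" where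
  "strongly_pattern_equivariant S G \<longleftrightarrow>
    (\<exists>R0. (\<forall>p. cball p (R0 / 3) \<inter> S \<noteq> {}) \<and>
      (\<exists>R>0. \<forall>x1\<in>S. \<forall>y1\<in>S. \<forall>x2\<in>S. \<forall>y2\<in>S.
        norm (y1 - x1) \<le> R0 \<and> norm (y2 - x2) \<le> R0 \<and> y1 - x1 = y2 - x2 \<and>
        agree_on_ball R (shift x1 S) (shift x2 S) \<longrightarrow> G x1 y1 = G x2 y2))"

definition shape_deformation_generator ::
  "'a::euclidean_space set \<Rightarrow> ('a \<Rightarrow> 'a) \<Rightarrow> bool" where
  "shape_deformation_generator S F \<longleftrightarrow> strongly_pattern_equivariant S (coboundary F)"

definition deformed_set :: "'a::euclidean_space set \<Rightarrow> ('a \<Rightarrow> 'a) \<Rightarrow> 'a set" where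
  "deformed_set S F = {x + F x | x. x \<in> S}"

definition transversal_extension ::
  "'a::euclidean_space set \<Rightarrow> ('a \<Rightarrow> 'a) \<Rightarrow> ('a set \<Rightarrow> 'a) \<Rightarrow> bool" where
  "transversal_extension S F Ft \<longleftrightarrow>
    continuous_map (subtopology (hull_topology S) (Xi S)) euclidean Ft \<and>
    (\<forall>x\<in>S. F x = Ft (shift x S))"

definition weakly_pattern_equivariant ::
  "'a::euclidean_space set \<Rightarrow> ('a \<Rightarrow> 'a) \<Rightarrow> bool" where
  "weakly_pattern_equivariant S F \<longleftrightarrow> (\<exists>Ft. transversal_extension S F Ft)"

text \<open>The values of \<open>Ft\<close> on \<open>Xi S\<close> are determined by \<open>F\<close>, because the sets \<open>shift x S\<close> with
  \<open>x \<in> S\<close> are dense there. The argument \<open>\<pi>\<close> is the maximal equicontinuous factor map.\<close>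

definition nonslip ::
  "'a::euclidean_space set \<Rightarrow> ('a set \<Rightarrow> 'y) \<Rightarrow> ('a \<Rightarrow> 'a) \<Rightarrow> bool" where
  "nonslip S \<pi> F \<longleftrightarrow>
    (\<exists>Ft. transversal_extension S F Ft \<and>
      (\<exists>e>0. \<forall>T1\<in>Xi S. \<forall>T2\<in>Xi S.
        \<pi> T1 = \<pi> T2 \<and> agree_on_ball (1 / e) T1 T2 \<longrightarrow> Ft T1 = Ft T2))"

end

theory Submission
  imports Defs "HOL-Library.Diagonal_Subsequence"
begin

text \<open>
  Let \<open>Ft\<close> be the continuous function on the transversal with \<open>F x = Ft (\<Lambda> - x)\<close>, and suppose that
  \<open>\<Lambda>\<^sup>F\<close> is a Meyer set. If \<open>F\<close> is not nonslip, then, by uniform continuity of \<open>Ft\<close>, there are \<open>T1\<close> and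
  \<open>T2\<close> in the transversal with the same image in the maximal equicontinuous factor, such that \<open>Ft T1 - Ft T2\<close> is nonzero but smaller than half
  the separation of \<open>\<Lambda>\<^sup>F - \<Lambda>\<^sup>F\<close>. The points \<open>T1\<close> and \<open>T2\<close> are regionally proximal: there are
  \<open>a, b, u, w\<close> with \<open>a - w = b - u\<close> such that \<open>\<Lambda> - a\<close> is close to \<open>T1\<close> and \<open>\<Lambda> - b\<close>, \<open>\<Lambda> - u\<close>,
  \<open>\<Lambda> - w\<close> are close to \<open>T2\<close>. After a small displacement these are points of \<open>\<Lambda>\<close>, and the equality
  survives because \<open>\<Lambda> - \<Lambda>\<close> is uniformly discrete. The two vectors \<open>a + F a - (w + F w)\<close> and
  \<open>b + F b - (u + F u)\<close> of \<open>\<Lambda>\<^sup>F - \<Lambda>\<^sup>F\<close> now differ by \<open>(F a - F w) - (F b - F u)\<close>, which is close to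
  \<open>Ft T1 - Ft T2\<close>. So they are distinct and too close to each other.

  That points with the same image in the maximal equicontinuous factor are regionally proximal is a
  theorem of Veech for minimal actions of abelian groups. The proof here follows McMahon: the fibres
  \<open>N\<^sub>x\<close> of a closed invariant relation all have the same measure with respect to an invariant measure, and
  they depend semicontinuously on \<open>x\<close>, so that the measure of the symmetric difference of \<open>N\<^sub>x\<close> and
  \<open>N\<^sub>y\<close> is a continuous invariant pseudometric. It factors through the maximal equicontinuous factor
  (\<open>invariant_pseudometric_vanishes_on_fibres\<close>), and fibres at distance \<open>0\<close> agree up to a null set,
  which yields the four translations (\<open>regional_proximality\<close>). Instead of a measure on the hull,
  a finitely additive invariant mean on the acting group is enough, applied to visiting times along
  one orbit; it exists by compactness (\<open>invariant_mean_exists\<close>).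

  The dynamical input is that the hull of a repetitive Delone set of finite local complexity is a compact
  minimal system (\<open>minimal_abelian_action_hull\<close>).
\<close>

section \<open>Invariant means on abelian groups\<close>

definition finitely_additive_probability :: "('g set \<Rightarrow> real) \<Rightarrow> bool" where
  "finitely_additive_probability m \<longleftrightarrow>
    m UNIV = 1 \<and> (\<forall>A. 0 \<le> m A) \<and> (\<forall>A B. A \<inter> B = {} \<longrightarrow> m (A \<union> B) = m A + m B)"

definition invariant_mean :: "('g::ab_group_add set \<Rightarrow> real) \<Rightarrow> bool" where
  "invariant_mean m \<longleftrightarrow> finitely_additive_probability m \<and> (\<forall>s A. m ((+) s ` A) = m A)"

context
  fixes m :: "'g set \<Rightarrow> real"
  assumes m: "finitely_additive_probability m"
begin

lemma mean_UNIV: "m UNIV = 1"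
  and mean_nonneg: "0 \<le> m A"
  and mean_disjoint_Un: "A \<inter> B = {} \<Longrightarrow> m (A \<union> B) = m A + m B"
  using m unfolding finitely_additive_probability_def by blast+

lemma mean_Diff: "A \<subseteq> B \<Longrightarrow> m (B - A) = m B - m A"
  using mean_disjoint_Un[of A "B - A"] by (simp add: Un_absorb1)

lemma mean_mono: "A \<subseteq> B \<Longrightarrow> m A \<le> m B"
  using mean_Diff[of A B] mean_nonneg[of "B - A"] by simp

lemma mean_le_1: "m A \<le> 1"
  using mean_mono[of A UNIV] mean_UNIV by simp

lemma mean_Un_Int: "m (A \<union> B) + m (A \<inter> B) = m A + m B"
  using mean_disjoint_Un[of A "B - A"] mean_Diff[of "A \<inter> B" B]
  by (simp add: Diff_Int)

lemma mean_empty: "m {} = 0"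
  using mean_disjoint_Un[of "{}" "{}"] by simp

lemma mean_UN_le: "finite I \<Longrightarrow> m (\<Union>i\<in>I. A i) \<le> (\<Sum>i\<in>I. m (A i))"
proof (induction I rule: finite_induct)
  case (insert i I)
  then show ?case
    using mean_Un_Int[of "A i" "\<Union>i\<in>I. A i"] mean_nonneg[of "A i \<inter> (\<Union>i\<in>I. A i)"] by simp
qed (simp add: mean_empty)

end

lemma funpow_translate_commute:
  fixes s t :: "'g::ab_group_add"
  shows "(+) t ` ((+) s ^^ n) ` A = ((+) s ^^ n) ` (+) t ` A"
proof -
  have "t + ((+) s ^^ n) x = ((+) s ^^ n) (t + x)" for x
    by (induction n) (simp_all add: add.left_commute)
  then show ?thesis by (simp add: image_image)
qed

text \<open>Averaging a mean over \<open>0, s, 2s, \<dots>, (N - 1)s\<close> makes it invariant under \<open>s\<close> up to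
  \<open>1 / N\<close>, by telescoping. Since the group is abelian, averaging does not increase the defect under the
  other elements of \<open>I\<close>, so they can be treated one after the other.\<close>

lemma almost_invariant_mean_exists:
  fixes I :: "'g::ab_group_add set"
  assumes "finite I" "0 < e"
  shows "\<exists>m. finitely_additive_probability m \<and> (\<forall>s\<in>I. \<forall>A. \<bar>m ((+) s ` A) - m A\<bar> \<le> e)"
  using assms(1)
proof (induction I rule: finite_induct)
  case empty
  have "finitely_additive_probability (\<lambda>A. if (0::'g) \<in> A then 1 else 0)"
    by (auto simp: finitely_additive_probability_def)
  then show ?case by blast
next
  case (insert s I)
  then obtain m where m: "finitely_additive_probability m"
      and inv: "\<And>t A. t \<in> I \<Longrightarrow> \<bar>m ((+) t ` A) - m A\<bar> \<le> e" by blast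
  obtain N :: nat where N: "1 / e < N" using reals_Archimedean2 by blast
  moreover have "0 < 1 / e" using assms(2) by simp
  ultimately have N0: "0 < real N" by linarith
  define T where "T n A = ((+) s ^^ n) ` A" for n and A :: "'g set"
  define m' where "m' A = (\<Sum>n<N. m (T n A)) / N" for A
  have inj: "inj ((+) s ^^ n)" for n
    by (induction n) (auto intro: inj_compose simp: inj_def)
  have surj: "surj ((+) s ^^ n)" for n
  proof (induction n)
    case (Suc n)
    then show ?case using comp_surj[OF Suc surj_plus] by (simp only: funpow.simps)
  qed simp
  have "finitely_additive_probability m'"
    unfolding finitely_additive_probability_def
  proof (intro conjI allI impI)
    show "m' UNIV = 1" using surj N0 by (simp add: m'_def T_def mean_UNIV[OF m])
    show "0 \<le> m' A" for A by (simp add: m'_def mean_nonneg[OF m] sum_nonneg)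
    show "m' (A \<union> B) = m' A + m' B" if "A \<inter> B = {}" for A B
    proof -
      have "T n A \<inter> T n B = {}" for n
        using image_Int[OF inj, of n A B] that by (simp add: T_def)
      then show ?thesis
        by (simp add: m'_def T_def image_Un mean_disjoint_Un[OF m] sum.distrib add_divide_distrib)
    qed
  qed
  moreover have "\<bar>m' ((+) t ` A) - m' A\<bar> \<le> e" if t: "t \<in> insert s I" for t A
  proof (cases "t = s")
    case True
    have "T n ((+) t ` A) = T (Suc n) A" for n
      unfolding T_def True funpow_translate_commute[symmetric] by (simp add: image_comp)
    then have "m' ((+) t ` A) - m' A = (\<Sum>n<N. m (T (Suc n) A) - m (T n A)) / N"
      by (simp add: m'_def sum_subtractf diff_divide_distrib)
    also have "\<dots> = (m (T N A) - m (T 0 A)) / N" by (subst sum_lessThan_telescope) simp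
    finally have "\<bar>m' ((+) t ` A) - m' A\<bar> \<le> 1 / N"
      using mean_nonneg[OF m, of "T N A"] mean_nonneg[OF m, of "T 0 A"]
        mean_le_1[OF m, of "T N A"] mean_le_1[OF m, of "T 0 A"] N0
      by (simp add: abs_le_iff divide_right_mono)
    also have "1 / N \<le> e" using N N0 assms(2) by (simp add: field_simps)
    finally show ?thesis .
  next
    case False
    have "\<bar>m' ((+) t ` A) - m' A\<bar> = \<bar>\<Sum>n<N. m ((+) t ` T n A) - m (T n A)\<bar> / N"
      by (simp add: m'_def T_def sum_subtractf diff_divide_distrib[symmetric] funpow_translate_commute)
    also have "\<dots> \<le> (\<Sum>n<N. e) / N"
      using inv t False by (intro divide_right_mono order_trans[OF sum_abs] sum_mono) auto
    also have "\<dots> = e" using N0 by simp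
    finally show ?thesis .
  qed
  ultimately show ?case by blast
qed

text \<open>The finitely additive probabilities form a closed subset of the compact product
  \<open>[0, 1]\<^bsup>Pow G\<^esup>\<close>. In it, almost invariance under one group element with a given error is a closed
  condition, and finitely many such conditions can be met together.\<close>

lemma invariant_mean_exists: "\<exists>m :: 'g::ab_group_add set \<Rightarrow> real. invariant_mean m"
proof -
  define K where "K = {m :: 'g set \<Rightarrow> real. finitely_additive_probability m}"
  define C where "C = (\<lambda>(s, k). {m :: 'g set \<Rightarrow> real. \<forall>A. \<bar>m ((+) s ` A) - m A\<bar> \<le> 1 / Suc k})"
  have cont: "continuous_on UNIV (\<lambda>m :: 'g set \<Rightarrow> real. m A)" for A by simp
  have closedC: "closed (C i)" for i
    unfolding C_def
    by (cases i) (auto intro!: closed_Collect_all closed_Collect_le continuous_intros simp del: of_nat_Suc)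
  have K_eq: "K = {m. m UNIV = 1} \<inter> (\<Inter>A. {m. 0 \<le> m A})
      \<inter> (\<Inter>A. \<Inter>B\<in>{B. A \<inter> B = {}}. {m. m (A \<union> B) = m A + m B})"
    by (auto simp: K_def finitely_additive_probability_def)
  have "closed K"
    unfolding K_eq
    by (intro closed_Int closed_INT ballI closed_Collect_eq closed_Collect_le continuous_intros cont)
  moreover have "compact (PiE UNIV (\<lambda>_ :: 'g set. {0..1 :: real}))"
    using compactin_PiE[of "\<lambda>_. euclidean" UNIV "\<lambda>_ :: 'g set. {0..1 :: real}"]
    by (simp add: euclidean_product_topology)
  moreover have "K \<subseteq> PiE UNIV (\<lambda>_. {0..1})"
    by (auto simp: K_def mean_nonneg mean_le_1)
  ultimately have "compact K"
    by (metis compact_Int_closed inf.absorb2)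
  then have "K \<inter> (\<Inter>i\<in>UNIV. C i) \<noteq> {}"
  proof (rule compact_imp_fip_image)
    fix I :: "('g \<times> nat) set" assume I: "finite I"
    define k where "k = Max (insert 0 (snd ` I))"
    obtain m where m: "finitely_additive_probability m"
        "\<And>s A. s \<in> fst ` I \<Longrightarrow> \<bar>m ((+) s ` A) - m A\<bar> \<le> 1 / Suc k"
      using almost_invariant_mean_exists[of "fst ` I" "1 / Suc k"] I by auto
    have "m \<in> C i" if "i \<in> I" for i
    proof -
      have "snd i \<le> k" using that I by (auto simp: k_def intro!: Max_ge)
      then have "1 / Suc k \<le> 1 / Suc (snd i)" by (simp add: frac_le)
      then have "\<bar>m ((+) (fst i) ` A) - m A\<bar> \<le> 1 / Suc (snd i)" for A
        using m(2)[of "fst i" A] that by (meson imageI order_trans)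
      then show ?thesis by (simp add: C_def case_prod_unfold)
    qed
    then show "K \<inter> (\<Inter>i\<in>I. C i) \<noteq> {}" using m(1) by (auto simp: K_def)
  qed (rule closedC)
  then obtain m where m: "m \<in> K" "\<And>s k. m \<in> C (s, k)" by auto
  have "m ((+) s ` A) = m A" for s A
  proof -
    have "\<bar>m ((+) s ` A) - m A\<bar> \<le> 0"
    proof (rule field_le_epsilon)
      fix e :: real assume "0 < e"
      then obtain k where "inverse (Suc k) < e" using reals_Archimedean by blast
      moreover have "\<bar>m ((+) s ` A) - m A\<bar> \<le> inverse (Suc k)"
        using m(2)[of s k] by (simp add: C_def inverse_eq_divide)
      ultimately show "\<bar>m ((+) s ` A) - m A\<bar> \<le> 0 + e" by linarith
    qed
    then show ?thesis by simp
  qed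
  then show ?thesis using m(1) by (auto simp: invariant_mean_def K_def)
qed

section \<open>Regional proximality for minimal abelian actions\<close>

text \<open>Identifying points at \<open>\<rho>\<close>-distance \<open>0\<close> gives a factor on which the action is isometric,
  hence equicontinuous; such pseudometrics are the test functions for the maximal equicontinuous factor.\<close>

definition invariant_pseudometric ::
  "'x set \<Rightarrow> ('x \<Rightarrow> 'x \<Rightarrow> real) \<Rightarrow> ('g \<Rightarrow> 'x \<Rightarrow> 'x) \<Rightarrow> ('x \<Rightarrow> 'x \<Rightarrow> real) \<Rightarrow> bool" where
  "invariant_pseudometric M d act \<rho> \<longleftrightarrow>
    (\<forall>x\<in>M. \<rho> x x = 0) \<and>
    (\<forall>x\<in>M. \<forall>y\<in>M. 0 \<le> \<rho> x y \<and> \<rho> x y = \<rho> y x) \<and>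
    (\<forall>x\<in>M. \<forall>y\<in>M. \<forall>z\<in>M. \<rho> x z \<le> \<rho> x y + \<rho> y z) \<and>
    (\<forall>v. \<forall>x\<in>M. \<forall>y\<in>M. \<rho> (act v x) (act v y) = \<rho> x y) \<and>
    (\<forall>x\<in>M. \<forall>e>0. \<exists>k>0. \<forall>y\<in>M. d x y < k \<longrightarrow> \<rho> x y < e)"

locale minimal_abelian_action = Metric_space M d
  for M :: "'x set" and d +
  fixes act :: "'g::ab_group_add \<Rightarrow> 'x \<Rightarrow> 'x"
  assumes compact: "compact_space mtopology"
    and act_continuous: "continuous_map mtopology mtopology (act v)"
    and act_zero: "x \<in> M \<Longrightarrow> act 0 x = x"
    and act_add: "x \<in> M \<Longrightarrow> act (u + v) x = act u (act v x)"
    and orbit_dense: "x \<in> M \<Longrightarrow> y \<in> M \<Longrightarrow> 0 < e \<Longrightarrow> \<exists>v. d x (act v y) < e"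
begin

lemma act_in: "x \<in> M \<Longrightarrow> act v x \<in> M"
  using act_continuous[of v] by (auto simp: continuous_map_def)

lemma act_continuousD:
  assumes "x \<in> M" "0 < e"
  obtains k where "0 < k" "\<And>y. y \<in> M \<Longrightarrow> d x y < k \<Longrightarrow> d (act v x) (act v y) < e"
proof -
  have "\<exists>k>0. \<forall>y. y \<in> M \<and> d x y < k \<longrightarrow> act v y \<in> mball (act v x) e"
    using act_continuous[of v] act_in[OF assms(1)] assms
    unfolding continuous_map_from_metric by (metis centre_in_mball_iff openin_mball)
  then show thesis using that by auto
qed

text \<open>The pairs \<open>(act a z, act (a + c) z)\<close> with \<open>c \<in> D\<close> form an invariant relation on the
  orbit of \<open>z\<close>. This is the set of times \<open>t = a + c\<close> at which the orbit is at the second point of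
  such a pair whose first point is \<open>e\<close>-close to \<open>x\<close>. For \<open>e \<rightarrow> 0\<close> these sets play the part of the
  fibre over \<open>x\<close> of the closure of the relation.\<close>

definition thickened_visits :: "'x \<Rightarrow> 'g set \<Rightarrow> real \<Rightarrow> 'x \<Rightarrow> 'g set" where
  "thickened_visits z D e x = {a + c |a c. d x (act a z) < e \<and> c \<in> D}"

text \<open>The measure of the union of the two fibres over \<open>x\<close> and \<open>y\<close>. A mean is only finitely
  additive, so the passage from neighbourhoods to the closed fibre is made after measuring, by the infimum
  over \<open>e\<close>.\<close>

definition joint_mean :: "('g set \<Rightarrow> real) \<Rightarrow> 'x \<Rightarrow> 'g set \<Rightarrow> 'x \<Rightarrow> 'x \<Rightarrow> real" where
  "joint_mean m z D x y =
    (INF e\<in>{0<..}. m (thickened_visits z D e x \<union> thickened_visits z D e y))"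

lemma thickened_visits_mono: "e \<le> e' \<Longrightarrow> thickened_visits z D e x \<subseteq> thickened_visits z D e' x"
  by (force simp: thickened_visits_def)

lemma thickened_visits_near:
  assumes "x \<in> M" "y \<in> M" "z \<in> M" "d x y < e / 2"
  shows "thickened_visits z D (e / 2) y \<subseteq> thickened_visits z D e x"
proof -
  have "d x (act a z) < e" if "d y (act a z) < e / 2" for a
    using triangle[of x y "act a z"] act_in assms that by fastforce
  then show ?thesis unfolding thickened_visits_def by blast
qed

lemma thickened_visits_translate:
  assumes "x \<in> M" "z \<in> M" "0 < e"
  obtains k where "0 < k" "(+) v ` thickened_visits z D k x \<subseteq> thickened_visits z D e (act v x)"
proof -
  obtain k where k: "0 < k" "\<And>y. y \<in> M \<Longrightarrow> d x y < k \<Longrightarrow> d (act v x) (act v y) < e"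
    using act_continuousD[OF assms(1,3)] by metis
  have "v + (a + c) \<in> thickened_visits z D e (act v x)"
    if "d x (act a z) < k" "c \<in> D" for a c
  proof -
    have "d (act v x) (act (v + a) z) < e"
      using k(2)[of "act a z"] that assms act_in by (simp add: act_add)
    then show ?thesis unfolding thickened_visits_def using that(2)
      by (smt (verit, best) add.assoc mem_Collect_eq)
  qed
  then show thesis using that[OF k(1)] by (force simp: thickened_visits_def)
qed

context
  fixes m :: "'g set \<Rightarrow> real" and z :: 'x and D :: "'g set"
  assumes m: "invariant_mean m" and z: "z \<in> M"
begin

private abbreviation "N \<equiv> thickened_visits z D"
private abbreviation "\<beta> \<equiv> joint_mean m z D"

private lemma fap: "finitely_additive_probability m" and inv: "m ((+) s ` A) = m A"
  using m by (auto simp: invariant_mean_def)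

private lemma joint_mean_le: "0 < e \<Longrightarrow> \<beta> x y \<le> m (N e x \<union> N e y)"
  unfolding joint_mean_def
  by (rule cINF_lower) (auto intro!: bdd_belowI[of _ 0] mean_nonneg[OF fap])

private lemma joint_mean_ge: "(\<And>e. 0 < e \<Longrightarrow> c \<le> m (N e x \<union> N e y)) \<Longrightarrow> c \<le> \<beta> x y"
  unfolding joint_mean_def by (rule cINF_greatest) (auto intro: exI[of _ 1])

private lemma joint_mean_commute: "\<beta> x y = \<beta> y x"
  by (simp add: joint_mean_def Un_commute)

private lemma joint_mean_approx:
  assumes "0 < k"
  obtains e where "0 < e" "m (N e x \<union> N e y) < \<beta> x y + k"
  using joint_mean_ge[of "\<beta> x y + k" x y] assms by force

text \<open>Submodularity of \<open>m\<close>: the union of \<open>N\<^sub>x \<union> N\<^sub>y\<close> and \<open>N\<^sub>y \<union> N\<^sub>w\<close> contains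
  \<open>N\<^sub>x \<union> N\<^sub>w\<close>, and their intersection contains \<open>N\<^sub>y\<close>.\<close>

private lemma joint_mean_triangle: "\<beta> x w + \<beta> y y \<le> \<beta> x y + \<beta> y w"
proof (rule field_le_epsilon)
  fix k :: real assume "0 < k"
  then have k2: "0 < k / 2" by simp
  obtain e1 where e1: "0 < e1" "m (N e1 x \<union> N e1 y) < \<beta> x y + k / 2"
    using joint_mean_approx[OF k2] .
  obtain e2 where e2: "0 < e2" "m (N e2 y \<union> N e2 w) < \<beta> y w + k / 2"
    using joint_mean_approx[OF k2] .
  define e where "e = min e1 e2"
  have e: "0 < e" "e \<le> e1" "e \<le> e2" using e1 e2 by (auto simp: e_def)
  have "\<beta> x w + \<beta> y y \<le> m (N e x \<union> N e w) + m (N e y)"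
    using joint_mean_le[OF e(1), of x w] joint_mean_le[OF e(1), of y y] by simp
  also have "\<dots> \<le> m ((N e x \<union> N e y) \<union> (N e y \<union> N e w)) + m ((N e x \<union> N e y) \<inter> (N e y \<union> N e w))"
    by (intro add_mono mean_mono[OF fap]) auto
  also have "\<dots> = m (N e x \<union> N e y) + m (N e y \<union> N e w)"
    by (rule mean_Un_Int[OF fap])
  also have "\<dots> \<le> m (N e1 x \<union> N e1 y) + m (N e2 y \<union> N e2 w)"
    by (intro add_mono mean_mono[OF fap] Un_mono thickened_visits_mono e)
  finally show "\<beta> x w + \<beta> y y \<le> \<beta> x y + \<beta> y w + k" using e1 e2 by linarith
qed

private lemma joint_mean_translate_le:
  assumes "x \<in> M" "y \<in> M"
  shows "\<beta> x y \<le> \<beta> (act v x) (act v y)"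
proof (rule joint_mean_ge)
  fix e :: real assume "0 < e"
  obtain k1 where k1: "0 < k1" "(+) v ` N k1 x \<subseteq> N e (act v x)"
    using thickened_visits_translate[OF assms(1) z \<open>0 < e\<close>] by metis
  obtain k2 where k2: "0 < k2" "(+) v ` N k2 y \<subseteq> N e (act v y)"
    using thickened_visits_translate[OF assms(2) z \<open>0 < e\<close>] by metis
  define k where "k = min k1 k2"
  have "(+) v ` (N k x \<union> N k y) \<subseteq> N e (act v x) \<union> N e (act v y)"
    using k1(2) k2(2) thickened_visits_mono[of k k1 z D x] thickened_visits_mono[of k k2 z D y]
    by (fastforce simp: k_def)
  then have "m (N k x \<union> N k y) \<le> m (N e (act v x) \<union> N e (act v y))"
    using mean_mono[OF fap] inv by metis
  then show "\<beta> x y \<le> m (N e (act v x) \<union> N e (act v y))"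
    using joint_mean_le[of k x y] k1 k2 by (simp add: k_def)
qed

private lemma joint_mean_translate:
  assumes "x \<in> M" "y \<in> M"
  shows "\<beta> (act v x) (act v y) = \<beta> x y"
proof (rule antisym)
  have "act (- v) (act v w) = w" if "w \<in> M" for w
    using act_add[OF that, of "- v" v] act_zero[OF that] by simp
  then show "\<beta> (act v x) (act v y) \<le> \<beta> x y"
    using joint_mean_translate_le[of "act v x" "act v y" "- v"] assms act_in by simp
qed (rule joint_mean_translate_le[OF assms])

private lemma joint_mean_upper_semicontinuous:
  assumes "x \<in> M" "0 < e"
  obtains k where "0 < k" "\<And>y. y \<in> M \<Longrightarrow> d x y < k \<Longrightarrow> \<beta> y x < \<beta> x x + e \<and> \<beta> y y < \<beta> x x + e"
proof -
  obtain k where k: "0 < k" "m (N k x \<union> N k x) < \<beta> x x + e"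
    using joint_mean_approx[OF assms(2)] .
  have "\<beta> y x < \<beta> x x + e \<and> \<beta> y y < \<beta> x x + e" if "y \<in> M" "d x y < k / 2" for y
  proof -
    have "N (k / 2) y \<union> N (k / 2) x \<subseteq> N k x" "N (k / 2) y \<union> N (k / 2) y \<subseteq> N k x"
      using thickened_visits_near[OF assms(1) that(1) z that(2)] thickened_visits_mono[of "k/2" k] k(1)
      by auto
    then have "m (N (k / 2) y \<union> N (k / 2) x) \<le> m (N k x)" "m (N (k / 2) y \<union> N (k / 2) y) \<le> m (N k x)"
      by (auto intro: mean_mono[OF fap])
    then show ?thesis
      using joint_mean_le[of "k/2" y x] joint_mean_le[of "k/2" y y] k by simp
  qed
  then show thesis using that[of "k/2"] k(1) by simp
qed

text \<open>An invariant upper semicontinuous function on a minimal system is constant, because every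
  orbit comes close to every point.\<close>

private lemma joint_mean_diagonal_constant:
  assumes "x \<in> M" "y \<in> M"
  shows "\<beta> x x = \<beta> y y"
proof -
  have *: "\<beta> y y \<le> \<beta> x x" if x: "x \<in> M" and y: "y \<in> M" for x y
  proof (rule field_le_epsilon)
    fix e :: real assume "0 < e"
    then obtain k where k: "0 < k" "\<And>y. y \<in> M \<Longrightarrow> d x y < k \<Longrightarrow> \<beta> y y < \<beta> x x + e"
      using joint_mean_upper_semicontinuous[OF x] by metis
    obtain v where "d x (act v y) < k" using orbit_dense[OF x y k(1)] by blast
    then show "\<beta> y y \<le> \<beta> x x + e"
      using k(2)[OF act_in[OF y]] joint_mean_translate[OF y y] by (metis less_imp_le)
  qed
  show ?thesis using *[OF assms] *[OF assms(2,1)] by simp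
qed

private lemma joint_mean_diagonal_le:
  assumes "x \<in> M"
  shows "\<beta> x x \<le> \<beta> x y"
  by (rule joint_mean_ge) (meson Un_upper1 joint_mean_le mean_mono[OF fap] order_trans sup.bounded_iff)

text \<open>All fibres have the same measure, so this difference is half the measure of the
  symmetric difference of the fibres over \<open>x\<close> and \<open>y\<close>. Its continuity rests on this constancy: for \<open>y\<close>
  close to \<open>x\<close> the fibre over \<open>y\<close> is nearly contained in the one over \<open>x\<close> by semicontinuity, and
  having the same measure it then nearly coincides with it.\<close>

lemma joint_mean_invariant_pseudometric:
  "invariant_pseudometric M d act (\<lambda>x y. joint_mean m z D x y - joint_mean m z D x x)"
  unfolding invariant_pseudometric_def
proof (intro conjI ballI allI impI)
  fix x y assume x: "x \<in> M" and y: "y \<in> M"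
  show "0 \<le> \<beta> x y - \<beta> x x" using joint_mean_diagonal_le[OF x] by simp
  show "\<beta> x y - \<beta> x x = \<beta> y x - \<beta> y y"
    using joint_mean_diagonal_constant[OF x y] joint_mean_commute[of x y] by simp
  show "\<beta> (act v x) (act v y) - \<beta> (act v x) (act v x) = \<beta> x y - \<beta> x x" for v
    using joint_mean_translate x y by simp
  show "\<beta> x w - \<beta> x x \<le> \<beta> x y - \<beta> x x + (\<beta> y w - \<beta> y y)" for w
    using joint_mean_triangle[of x w y] by simp
next
  fix x e assume "x \<in> M" and "0 < (e::real)"
  then obtain k where "0 < k" "\<And>y. y \<in> M \<Longrightarrow> d x y < k \<Longrightarrow> \<beta> y x < \<beta> x x + e"
    using joint_mean_upper_semicontinuous by metis
  then show "\<exists>k>0. \<forall>y\<in>M. d x y < k \<longrightarrow> \<beta> x y - \<beta> x x < e"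
    by (metis diff_less_eq joint_mean_commute add.commute)
qed simp

text \<open>Fibres at distance \<open>0\<close> agree up to measure \<open>0\<close>, so a set of positive mean in one
  meets the other.\<close>

lemma positive_mean_meets_thickened_visits:
  assumes "0 < e" "joint_mean m z D x y = joint_mean m z D x x"
    and "\<And>e. 0 < e \<Longrightarrow> W \<subseteq> thickened_visits z D e y" and "0 < m W"
  shows "W \<inter> thickened_visits z D e x \<noteq> {}"
proof
  assume disj: "W \<inter> N e x = {}"
  have "\<beta> x x + m W \<le> \<beta> x y"
  proof (rule joint_mean_ge)
    fix k :: real assume "0 < k"
    define r where "r = min k e"
    have r: "0 < r" using \<open>0 < k\<close> assms(1) by (simp add: r_def)
    have "W \<inter> N r x = {}" using disj thickened_visits_mono[of r e z D x] by (auto simp: r_def)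
    then have "m (N r x) + m W = m (N r x \<union> W)"
      using mean_disjoint_Un[OF fap, of "N r x" W] by (simp add: Int_commute)
    also have "\<dots> \<le> m (N k x \<union> N k y)"
      using thickened_visits_mono[of r k z D x] assms(3)[OF \<open>0 < k\<close>]
      by (intro mean_mono[OF fap]) (auto simp: r_def)
    finally show "\<beta> x x + m W \<le> m (N k x \<union> N k y)"
      using joint_mean_le[OF r, of x x] by simp
  qed
  then show False using assms(2,4) by simp
qed

end

text \<open>By minimality and compactness finitely many translates of this set of return times cover
  the group.\<close>

lemma visits_mean_pos:
  assumes m: "invariant_mean m" and "y \<in> M" "z \<in> M" "0 < e"
  shows "0 < m {a. d y (act a z) < e}"
proof -
  define W where "W = {a. d y (act a z) < e}"
  define U where "U s = {x \<in> M. act s x \<in> mball y e}" for s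
  have fap: "finitely_additive_probability m" and inv: "\<And>s A. m ((+) s ` A) = m A"
    using m by (auto simp: invariant_mean_def)
  have "openin mtopology (U s)" for s
    using openin_continuous_map_preimage[OF act_continuous[of s] openin_mball[of y e]]
    by (simp add: U_def)
  moreover have "M \<subseteq> (\<Union>s. U s)"
    using orbit_dense[OF assms(2) _ assms(4)] act_in assms(2) by (fastforce simp: U_def)
  ultimately obtain I where I: "finite I" "M \<subseteq> (\<Union>s\<in>I. U s)"
    using compact[unfolded compact_space_def compactin_def, THEN conjunct2, rule_format, of "range U"]
    by simp (metis finite_subset_image subset_UNIV)
  have "UNIV = (\<Union>s\<in>I. (+) (- s) ` W)"
  proof -
    have "v \<in> (\<Union>s\<in>I. (+) (- s) ` W)" for v
    proof -
      obtain s where s: "s \<in> I" "act s (act v z) \<in> mball y e"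
        using I(2) act_in[OF assms(3), of v] by (auto simp: U_def)
      then have "s + v \<in> W" using assms(3) by (simp add: W_def act_add)
      then show ?thesis using s(1) by (auto intro!: bexI[of _ s] image_eqI[of _ _ "s + v"])
    qed
    then show ?thesis by blast
  qed
  then have "1 \<le> (\<Sum>s\<in>I. m ((+) (- s) ` W))"
    using mean_UN_le[OF fap I(1), of "\<lambda>s. (+) (- s) ` W"] mean_UNIV[OF fap] by simp
  then have "1 \<le> card I * m W" by (simp only: inv sum_constant)
  then have "m W \<noteq> 0" by auto
  then show ?thesis using mean_nonneg[OF fap, of W] by (simp add: W_def)
qed

text \<open>Apply the pseudometric above with \<open>D = W - W\<close>, where \<open>W\<close> is the set of times at which the
  orbit of \<open>z\<close> is close to \<open>y\<close>. Then \<open>W\<close> lies in the fibre over \<open>y\<close> and therefore meets the fibre over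
  \<open>x\<close>: some \<open>b \<in> W\<close> has the form \<open>a + (u - w)\<close> with \<open>u, w \<in> W\<close> and \<open>a\<close> a time at which the orbit
  is close to \<open>x\<close>. In dynamical terms, the translation by \<open>w - a\<close> takes \<open>act a z\<close>, near \<open>x\<close>, and
  \<open>act b z\<close>, near \<open>y\<close>, to two points that are both near \<open>y\<close>.\<close>

theorem regional_proximality:
  assumes x: "x \<in> M" and y: "y \<in> M" and z: "z \<in> M" and "0 < e"
    and unseparated: "\<And>\<rho>. invariant_pseudometric M d act \<rho> \<Longrightarrow> \<rho> x y = 0"
  obtains a b u w where "d x (act a z) < e" "d y (act b z) < e" "d y (act u z) < e"
    "d y (act w z) < e" "a - w = b - u"
proof -
  obtain m :: "'g set \<Rightarrow> real" where m: "invariant_mean m" using invariant_mean_exists by blast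
  define W where "W = {a. d y (act a z) < e}"
  define D where "D = {u - w |u w. u \<in> W \<and> w \<in> W}"
  have "W \<subseteq> thickened_visits z D k y" if k: "0 < k" for k
  proof
    fix b assume "b \<in> W"
    \<comment> \<open>a single visit to the smaller ball lies in \<open>W\<close> itself, so that \<open>b - a \<in> W - W\<close>\<close>
    obtain a where "d y (act a z) < min k e" using orbit_dense[OF y z, of "min k e"] \<open>0 < e\<close> k by auto
    then have "d y (act a z) < k" "b - a \<in> D" using \<open>b \<in> W\<close> by (auto simp: D_def W_def)
    then have "a + (b - a) \<in> thickened_visits z D k y" unfolding thickened_visits_def by blast
    then show "b \<in> thickened_visits z D k y" by simp
  qed
  moreover have "joint_mean m z D x y = joint_mean m z D x x"
    using unseparated[OF joint_mean_invariant_pseudometric[OF m z]] by simp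
  moreover have "0 < m W" unfolding W_def by (rule visits_mean_pos[OF m y z \<open>0 < e\<close>])
  ultimately have "W \<inter> thickened_visits z D e x \<noteq> {}"
    using positive_mean_meets_thickened_visits[OF m z \<open>0 < e\<close>] by blast
  then obtain a u w where "d x (act a z) < e" "u \<in> W" "w \<in> W" "a + (u - w) \<in> W"
    by (auto simp: thickened_visits_def D_def)
  then show thesis using that[of a "a + (u - w)" u w] by (simp add: W_def)
qed

end

section \<open>The hull as a compact minimal system\<close>

lemma shift_shift: "shift u (shift v S) = shift (u + v) S"
  by (auto simp: mem_shift add.assoc add.commute[of u v] set_eq_iff)

lemma shift_0: "shift 0 S = S"
  by (simp add: shift_def)

lemma agree_on_ballD: "agree_on_ball R S T \<Longrightarrow> norm p \<le> R \<Longrightarrow> p \<in> S \<longleftrightarrow> p \<in> T"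
  by (auto simp: agree_on_ball_def set_eq_iff)

lemma agree_on_ballI: "(\<And>p. norm p \<le> R \<Longrightarrow> p \<in> S \<longleftrightarrow> p \<in> T) \<Longrightarrow> agree_on_ball R S T"
  by (auto simp: agree_on_ball_def)

lemma delone_set_shift:
  assumes "delone_set S"
  shows "delone_set (shift v S)"
proof -
  obtain e where e: "0 < e" "\<And>x y. x \<in> S \<Longrightarrow> y \<in> S \<Longrightarrow> dist x y < e \<Longrightarrow> x = y"
    using assms by (auto simp: delone_set_def uniform_discrete_def)
  obtain R where R: "0 < R" "\<And>p. \<exists>x\<in>S. dist p x \<le> R"
    using assms unfolding delone_set_def relatively_dense_def by blast
  have "x = y" if "x \<in> shift v S" "y \<in> shift v S" "dist x y < e" for x y
    using e(2)[of "x + v" "y + v"] that by (simp add: mem_shift)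
  moreover have "\<exists>x\<in>shift v S. dist p x \<le> R" for p
  proof -
    obtain x where "x \<in> S" "dist (p + v) x \<le> R" using R(2) by blast
    moreover have "dist p (x - v) = dist (p + v) x" by (simp add: dist_norm algebra_simps)
    ultimately show ?thesis by (intro bexI[of _ "x - v"]) (simp_all add: mem_shift)
  qed
  ultimately show ?thesis using e(1) R(1)
    unfolding delone_set_def uniform_discrete_def relatively_dense_def by blast
qed

lemma delone_dist_shift_shift_le:
  fixes S :: "'a::euclidean_space set"
  shows "delone_dist (shift u S) (shift v S) \<le> norm (u - v)"
proof (rule field_le_epsilon)
  fix k :: real assume k: "0 < k"
  have "agree_on_ball (1 / (norm (u - v) + k)) (shift (v - u) (shift u S)) (shift 0 (shift v S))"
    by (simp add: shift_shift agree_on_ball_def)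
  moreover have "norm (v - u) \<le> norm (u - v) + k" "norm (0::'a) \<le> norm (u - v) + k"
    using k norm_minus_commute[of v u] by simp_all
  ultimately have "delone_close (norm (u - v) + k) (shift u S) (shift v S)"
    unfolding delone_close_def by blast
  then show "delone_dist (shift u S) (shift v S) \<le> norm (u - v) + k"
    using delone_dist_le k by (metis add_nonneg_pos norm_ge_zero)
qed

lemma delone_dist_le_of_agree:
  assumes "0 < R" "agree_on_ball R S T"
  shows "delone_dist S T \<le> 1 / R"
proof (rule delone_dist_le)
  show "delone_close (1 / R) S T"
    unfolding delone_close_def using assms by (intro exI[of _ 0]) (simp add: shift_0)
qed (use assms in simp)

lemma delone_dist_shift_less:
  fixes v :: "'a::euclidean_space"
  assumes "0 < e"
  obtains k where "0 < k" "\<And>S T. delone_dist S T < k \<Longrightarrow> delone_dist (shift v S) (shift v T) < e"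
proof -
  define e' where "e' = min (e / 2) (1 / 2)"
  have e': "0 < e'" "e' < e" "e' < 1" using assms by (auto simp: e'_def)
  define k where "k = 1 / (1 / e' + norm v)"
  have "0 < 1 / e' + norm v" using e'(1) by (simp add: add_pos_nonneg)
  then have k: "0 < k" "1 / k = 1 / e' + norm v" by (auto simp: k_def)
  have "1 / e' \<le> 1 / k" using k(2) by simp
  then have "k \<le> e'" using k(1) e'(1) by (simp add: field_simps)
  have "delone_dist (shift v S) (shift v T) < e" if "delone_dist S T < k" for S T
  proof -
    have "delone_close k S T" using delone_dist_less[OF that] \<open>k \<le> e'\<close> e' by simp
    then obtain u w where uw: "norm u \<le> k" "norm w \<le> k" "agree_on_ball (1 / k) (shift u S) (shift w T)"
      unfolding delone_close_def by blast
    have "agree_on_ball (1 / e') (shift u (shift v S)) (shift w (shift v T))"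
    proof (rule agree_on_ballI)
      fix p :: 'a assume p: "norm p \<le> 1 / e'"
      then have "norm (p + v) \<le> 1 / k" using k(2) norm_triangle_ineq[of p v] by linarith
      then show "p \<in> shift u (shift v S) \<longleftrightarrow> p \<in> shift w (shift v T)"
        using agree_on_ballD[OF uw(3), of "p + v"] by (simp add: mem_shift ac_simps)
    qed
    moreover have "norm u \<le> e'" "norm w \<le> e'" using uw \<open>k \<le> e'\<close> by linarith+
    ultimately have "delone_close e' (shift v S) (shift v T)" unfolding delone_close_def by blast
    then show ?thesis using delone_dist_le[OF e'(1)] e'(2) by fastforce
  qed
  then show thesis using that k(1) by blast
qed

interpretation delone: Metric_space "Collect delone_set" delone_dist
  by (rule Metric_space_delone)

lemma mtopology_of_delone_metric: "mtopology_of delone_metric = delone.mtopology"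
  by (simp add: delone_metric_def delone.mtopology_of)

lemma in_delone_hull_iff:
  assumes "delone_set S"
  shows "T \<in> delone_hull S \<longleftrightarrow> delone_set T \<and> (\<forall>e>0. \<exists>v. delone_dist T (shift v S) < e)"
  unfolding delone_hull_def mtopology_of_delone_metric delone.metric_closure_of
  using delone_set_shift[OF assms] by (auto simp: delone.in_mball)

lemma delone_set_hull: "T \<in> delone_hull S \<Longrightarrow> delone_set T"
  unfolding delone_hull_def mtopology_of_delone_metric delone.metric_closure_of by simp

lemma Metric_space_delone_hull: "Metric_space (delone_hull S) delone_dist"
  by (rule delone.subspace) (auto dest: delone_set_hull)

lemma hull_topology_eq: "hull_topology S = Metric_space.mtopology (delone_hull S) delone_dist"
proof -
  interpret Submetric "Collect delone_set" delone_dist "delone_hull S"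
    by unfold_locales (auto dest: delone_set_hull)
  show ?thesis by (simp add: hull_topology_def mtopology_of_delone_metric mtopology_submetric)
qed

lemma shift_in_hull: "delone_set S \<Longrightarrow> shift v S \<in> delone_hull S"
  using delone_set_shift[of S v] by (auto simp: in_delone_hull_iff intro!: exI[of _ v])

lemma shift_hull:
  assumes "delone_set S" "T \<in> delone_hull S"
  shows "shift v T \<in> delone_hull S"
  unfolding in_delone_hull_iff[OF assms(1)]
proof (intro conjI allI impI)
  show "delone_set (shift v T)" using assms(2) delone_set_hull delone_set_shift by blast
  fix e :: real assume "0 < e"
  then obtain k where k: "0 < k" "\<And>A B. delone_dist A B < k \<Longrightarrow> delone_dist (shift v A) (shift v B) < e"
    using delone_dist_shift_less[of e v] by metis
  then show "\<exists>w. delone_dist (shift v T) (shift w S) < e"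
    using assms by (metis in_delone_hull_iff shift_shift)
qed

text \<open>By pigeonhole, a subsequence has constant patches of a given radius; the diagonal sequence has
  constant patches of radius \<open>k + 1\<close> from index \<open>k + 1\<close> on.\<close>

lemma patch_convergent_subsequence:
  fixes X :: "nat \<Rightarrow> 'a::euclidean_space set"
  assumes "\<And>R. 0 < R \<Longrightarrow> finite (range (\<lambda>n. cball 0 R \<inter> X n))"
  obtains r T where "strict_mono (r :: nat \<Rightarrow> nat)"
    "\<And>k n. k < n \<Longrightarrow> agree_on_ball (real (Suc k)) (X (r n)) T"
proof -
  define patch where "patch k n = cball 0 (real (Suc k)) \<inter> X n" for k n
  interpret subseqs "\<lambda>k s. \<forall>m n. patch k (s m) = patch k (s n)"
  proof
    fix k and s :: "nat \<Rightarrow> nat"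
    have "finite (range (\<lambda>n. patch k (s n)))"
      using assms[of "real (Suc k)"]
      by (rule rev_finite_subset) (auto simp: patch_def)
    then obtain n0 where "infinite {n. patch k (s n) = patch k (s n0)}"
      using pigeonhole_infinite[OF infinite_UNIV_nat, of "\<lambda>n. patch k (s n)"] by auto
    from infinite_enumerate[OF this] obtain r :: "nat \<Rightarrow> nat"
      where r: "strict_mono r" "\<And>n. patch k (s (r n)) = patch k (s n0)" by blast
    then have "patch k ((s \<circ> r) m) = patch k ((s \<circ> r) n)" for m n by simp
    then show "\<exists>r :: nat \<Rightarrow> nat. strict_mono r \<and> (\<forall>m n. patch k ((s \<circ> r) m) = patch k ((s \<circ> r) n))"
      by (intro exI[of _ r] conjI allI r(1))
  qed
  define T where "T = {p. \<exists>N. \<forall>n\<ge>N. p \<in> X (diagseq n)}"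
  have const: "patch k (diagseq m) = patch k (diagseq n)" if "k < m" "k < n" for k m n
  proof -
    have "\<forall>m n. patch k ((diagseq \<circ> (+) (Suc k)) m) = patch k ((diagseq \<circ> (+) (Suc k)) n)"
      by (rule diagseq_holds) (simp only: comp_apply, blast)
    then have "patch k ((diagseq \<circ> (+) (Suc k)) (m - Suc k)) = patch k ((diagseq \<circ> (+) (Suc k)) (n - Suc k))"
      by (elim allE)
    then show ?thesis using that by simp
  qed
  have "agree_on_ball (real (Suc k)) (X (diagseq n)) T" if "k < n" for k n
  proof (rule agree_on_ballI)
    fix p :: 'a assume p: "norm p \<le> real (Suc k)"
    have *: "p \<in> X (diagseq i) \<longleftrightarrow> p \<in> X (diagseq n)" if "k < i" for i
      using const[OF that \<open>k < n\<close>] p by (auto simp: patch_def set_eq_iff simp del: of_nat_Suc)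
    show "p \<in> X (diagseq n) \<longleftrightarrow> p \<in> T"
    proof
      assume "p \<in> X (diagseq n)"
      then show "p \<in> T" using * unfolding T_def by (auto intro!: exI[of _ "Suc k"])
    next
      assume "p \<in> T"
      then obtain N where "\<And>i. N \<le> i \<Longrightarrow> p \<in> X (diagseq i)" by (auto simp: T_def)
      then show "p \<in> X (diagseq n)" using *[of "max N (Suc k)"] by simp
    qed
  qed
  then show thesis using that[OF subseq_diagseq] by blast
qed

text \<open>Both constants of a Delone set can be read off from bounded patches.\<close>

lemma delone_set_local_limit:
  assumes "delone_set S" and "\<And>R. \<exists>x. agree_on_ball R (shift x S) T"
  shows "delone_set T"
proof -
  obtain e where e: "0 < e" "\<And>x y. x \<in> S \<Longrightarrow> y \<in> S \<Longrightarrow> dist x y < e \<Longrightarrow> x = y"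
    using assms by (auto simp: delone_set_def uniform_discrete_def)
  obtain K where K: "0 < K" "\<And>p. \<exists>x\<in>S. dist p x \<le> K"
    using assms unfolding delone_set_def relatively_dense_def by blast
  have "p = q" if "p \<in> T" "q \<in> T" "dist p q < e" for p q
  proof -
    obtain x where x: "agree_on_ball (max (norm p) (norm q)) (shift x S) T" using assms(2) by blast
    have "p + x \<in> S" "q + x \<in> S"
      using agree_on_ballD[OF x, of p] agree_on_ballD[OF x, of q] that by (auto simp: mem_shift)
    then show ?thesis using e(2)[of "p + x" "q + x"] that(3) by simp
  qed
  moreover have "\<exists>q\<in>T. dist p q \<le> K" for p
  proof -
    obtain x where x: "agree_on_ball (norm p + K) (shift x S) T" using assms(2) by blast
    obtain y where y: "y \<in> S" "dist (p + x) y \<le> K" using K(2) by blast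
    have d: "dist p (y - x) = dist (p + x) y" by (simp add: dist_norm algebra_simps)
    have "norm (y - x) \<le> norm p + K"
      using d y(2) norm_triangle_ineq4[of p "p - (y - x)"] by (simp add: dist_norm)
    then have "y - x \<in> T" using agree_on_ballD[OF x, of "y - x"] y(1) by (simp add: mem_shift)
    then show ?thesis using d y(2) by (intro bexI[of _ "y - x"]) simp_all
  qed
  ultimately show ?thesis using e(1) K(1)
    unfolding delone_set_def uniform_discrete_def relatively_dense_def by blast
qed

text \<open>Split a translation vector into a nearby point of \<open>S\<close> and a bounded remainder: the remainder
  converges along a subsequence by compactness, and the translates by points of \<open>S\<close> do so because they have
  finitely many patches of each size.\<close>

lemma orbit_convergent_subsequence:
  fixes v :: "nat \<Rightarrow> 'a::euclidean_space"
  assumes S: "delone_set S" and flc: "finite_local_complexity S"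
  obtains T r where "delone_set T" "strict_mono (r :: nat \<Rightarrow> nat)"
    "\<And>e. 0 < e \<Longrightarrow> \<forall>\<^sub>F n in sequentially. delone_dist (shift (v (r n)) S) T < e"
proof -
  obtain K where K: "\<And>p. \<exists>x\<in>S. dist p x \<le> K"
    using S unfolding delone_set_def relatively_dense_def by blast
  have "\<exists>x. \<forall>n. x n \<in> S \<and> dist (v n) (x n) \<le> K"
    by (rule choice) (use K in blast)
  then obtain x where x: "\<And>n. x n \<in> S" "\<And>n. dist (v n) (x n) \<le> K" by blast
  have "\<forall>n. v n - x n \<in> cball 0 K" using x(2) by (simp add: dist_norm norm_minus_commute)
  then obtain w r1 where r1: "strict_mono (r1 :: nat \<Rightarrow> nat)"
      and w: "((\<lambda>n. v n - x n) \<circ> r1) \<longlonglongrightarrow> w"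
    using compact_cball[of "0::'a" K] unfolding compact_def by metis
  define X where "X n = shift (x (r1 n)) S" for n
  have "finite (range (\<lambda>n. cball 0 R \<inter> X n))" if "0 < R" for R
  proof (rule finite_subset)
    show "finite {cball 0 R \<inter> shift x S |x. x \<in> S}"
      using flc that by (simp add: finite_local_complexity_def)
  qed (use x(1) in \<open>auto simp: X_def\<close>)
  then obtain r2 T where r2: "strict_mono (r2 :: nat \<Rightarrow> nat)"
      and T: "\<And>k n. k < n \<Longrightarrow> agree_on_ball (real (Suc k)) (X (r2 n)) T"
    using patch_convergent_subsequence[of X] by metis
  have DT: "delone_set T"
  proof (rule delone_set_local_limit[OF S])
    fix R :: real
    obtain k :: nat where "R \<le> k" using real_arch_simple by blast
    then have "agree_on_ball R (X (r2 (Suc k))) T"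
      using agree_on_ballD[OF T[of k "Suc k"]] by (intro agree_on_ballI) simp
    then show "\<exists>x. agree_on_ball R (shift x S) T" unfolding X_def by blast
  qed
  define r where "r = r1 \<circ> r2"
  have lim: "(\<lambda>n. v (r n) - x (r n)) \<longlonglongrightarrow> w"
    using LIMSEQ_subseq_LIMSEQ[OF w r2] by (simp add: r_def o_def)
  have near: "\<forall>\<^sub>F n in sequentially. delone_dist (shift (v (r n)) S) (shift w T) < e" if "0 < e" for e
  proof -
    obtain k where k: "0 < k" "\<And>A B. delone_dist A B < k \<Longrightarrow> delone_dist (shift w A) (shift w B) < e / 2"
      using delone_dist_shift_less[OF half_gt_zero[OF \<open>0 < e\<close>], of w] by metis
    obtain j where j: "inverse (Suc j) < k" using reals_Archimedean[OF k(1)] by blast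
    have "\<forall>\<^sub>F n in sequentially. dist (v (r n) - x (r n)) w < e / 2"
      using tendstoD[OF lim half_gt_zero[OF \<open>0 < e\<close>]] .
    moreover have "\<forall>\<^sub>F n in sequentially. j < n" by (rule eventually_gt_at_top)
    ultimately show ?thesis
    proof eventually_elim
      case (elim n)
      have "delone_dist (X (r2 n)) T < k"
        using delone_dist_le_of_agree[OF _ T[OF elim(2)]] j
        by (simp add: inverse_eq_divide)
      then have "delone_dist (shift w (X (r2 n))) (shift w T) < e / 2" by (rule k(2))
      moreover have "delone_dist (shift (v (r n)) S) (shift w (X (r2 n))) < e / 2"
        using delone_dist_shift_shift_le[of "v (r n) - x (r n)" "X (r2 n)" w] elim(1)
        by (simp add: X_def shift_shift r_def dist_norm)
      moreover have "delone_dist (shift (v (r n)) S) (shift w T) \<le>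
          delone_dist (shift (v (r n)) S) (shift w (X (r2 n))) + delone_dist (shift w (X (r2 n))) (shift w T)"
        by (rule delone.triangle) (simp_all add: X_def delone_set_shift S DT)
      ultimately show ?case by linarith
    qed
  qed
  have "strict_mono r" unfolding r_def by (rule strict_mono_o[OF r1 r2])
  then show thesis by (rule that[OF delone_set_shift[OF DT] _ near])
qed

lemma compact_delone_hull:
  assumes S: "delone_set S" and flc: "finite_local_complexity S"
  shows "compact_space (hull_topology S)"
proof -
  have "delone.mtopology derived_set_of A \<noteq> {}" if inf: "infinite A" and A: "A \<subseteq> range (\<lambda>v. shift v S)" for A
  proof -
    obtain f :: "nat \<Rightarrow> 'a set" where f: "inj f" "range f \<subseteq> A"
      using infinite_countable_subset[OF inf] by blast
    then have "\<forall>n. \<exists>v. f n = shift v S" using A by blast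
    then obtain v where v: "\<And>n. f n = shift (v n) S" by metis
    obtain T r where T: "delone_set T" "strict_mono (r :: nat \<Rightarrow> nat)"
      "\<And>e. 0 < e \<Longrightarrow> \<forall>\<^sub>F n in sequentially. delone_dist (shift (v (r n)) S) T < e"
      using orbit_convergent_subsequence[OF S flc, of v] by metis
    have "infinite (A \<inter> delone.mball T e)" if e: "0 < e" for e
    proof -
      obtain N where N: "\<And>n. N \<le> n \<Longrightarrow> delone_dist (shift (v (r n)) S) T < e"
        using T(3)[OF e] by (auto simp: eventually_sequentially)
      have "(f \<circ> r) ` {N..} \<subseteq> A \<inter> delone.mball T e"
        using f(2) N T(1) by (auto simp: v delone_set_shift S delone.commute)
      moreover have "inj (f \<circ> r)" using f(1) T(2) by (simp add: inj_compose strict_mono_imp_inj_on)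
      then have "infinite ((f \<circ> r) ` {N..})"
        by (metis finite_imageD infinite_Ici inj_on_subset subset_UNIV)
      ultimately show ?thesis using finite_subset by blast
    qed
    then show ?thesis using T(1) by (auto simp: delone.derived_set_of_infinite_mball)
  qed
  then have "compactin delone.mtopology (delone.mtopology closure_of range (\<lambda>v. shift v S))"
    by (simp add: delone.compact_closure_of_eq_Bolzano_Weierstrass)
  then show ?thesis
    by (simp add: hull_topology_def delone_hull_def mtopology_of_delone_metric compact_space_subtopology)
qed

text \<open>Minimality of the hull. A patch of \<open>S\<close> that approximates \<open>x\<close> recurs in every ball of some
  radius \<open>R'\<close>; since \<open>y\<close> agrees with a translate of \<open>S\<close> on a ball of that size, up to a small
  translation, it contains a copy of the patch.\<close>

lemma repetitive_orbit_dense: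
  assumes S: "delone_set S" and rep: "repetitive S"
    and x: "x \<in> delone_hull S" and y: "y \<in> delone_hull S" and "0 < e"
  shows "\<exists>v. delone_dist x (shift v y) < e"
proof -
  have e2: "0 < e / 2" using \<open>0 < e\<close> by simp
  obtain a where a: "delone_dist x (shift a S) < e / 2"
    using x e2 unfolding in_delone_hull_iff[OF S] by blast
  define R where "R = 4 / e"
  have R: "0 < R" "1 / R < e / 2" using \<open>0 < e\<close> by (auto simp: R_def)
  have "\<exists>R'>0. \<forall>p. \<exists>t. (+) t ` cball a R \<subseteq> cball p R' \<and> S \<inter> (+) t ` cball a R = (+) t ` (S \<inter> cball a R)"
    using rep compact_cball[of a R] unfolding repetitive_def by blast
  then obtain R' where R': "0 < R'"
      "\<And>p. \<exists>t. (+) t ` cball a R \<subseteq> cball p R' \<and> S \<inter> (+) t ` cball a R = (+) t ` (S \<inter> cball a R)"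
    by blast
  define k where "k = min 1 (1 / R')"
  have k: "0 < k" "k \<le> 1" "R' \<le> 1 / k" using R'(1) by (auto simp: k_def min_def field_simps)
  obtain b where "delone_dist y (shift b S) < k"
    using y k(1) unfolding in_delone_hull_iff[OF S] by blast
  then obtain u w where uw: "agree_on_ball (1 / k) (shift u y) (shift w (shift b S))"
    using delone_dist_less(2)[OF _ k(2)] unfolding delone_close_def by blast
  obtain t where t: "(+) t ` cball a R \<subseteq> cball (b + w) R'"
      "S \<inter> (+) t ` cball a R = (+) t ` (S \<inter> cball a R)"
    using R'(2) by blast
  have "agree_on_ball R (shift a S) (shift (a + t - b - w + u) y)"
  proof (rule agree_on_ballI)
    fix q :: 'a assume q: "norm q \<le> R"
    then have qB: "q + a \<in> cball a R" by (simp add: dist_norm)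
    have "t + (q + a) \<in> (+) t ` (S \<inter> cball a R) \<longleftrightarrow> q + a \<in> S \<inter> cball a R"
      by (rule inj_image_mem_iff) simp
    then have "q + a \<in> S \<longleftrightarrow> t + (q + a) \<in> S"
      unfolding t(2)[symmetric] using qB by blast
    moreover have "t + (q + a) \<in> cball (b + w) R'" using t(1) qB by blast
    then have "norm (t + (q + a) - (b + w)) \<le> 1 / k"
      using k(3) by (simp add: dist_norm norm_minus_commute)
    from agree_on_ballD[OF uw this]
    have "t + (q + a) \<in> S \<longleftrightarrow> q + (a + t - b - w + u) \<in> y"
      by (simp add: mem_shift algebra_simps)
    ultimately show "q \<in> shift a S \<longleftrightarrow> q \<in> shift (a + t - b - w + u) y" by (simp add: mem_shift)
  qed
  then have "delone_dist (shift a S) (shift (a + t - b - w + u) y) < e / 2"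
    using delone_dist_le_of_agree[OF R(1)] R(2) by fastforce
  moreover have "delone_dist x (shift (a + t - b - w + u) y)
      \<le> delone_dist x (shift a S) + delone_dist (shift a S) (shift (a + t - b - w + u) y)"
    using x y S by (intro delone.triangle) (auto dest: delone_set_hull simp: delone_set_shift)
  ultimately show ?thesis using a by (intro exI[of _ "a + t - b - w + u"]) linarith
qed

lemma minimal_abelian_action_hull:
  assumes S: "delone_set S" and flc: "finite_local_complexity S" and rep: "repetitive S"
  shows "minimal_abelian_action (delone_hull S) delone_dist shift"
proof -
  interpret hull: Metric_space "delone_hull S" delone_dist by (rule Metric_space_delone_hull)
  show ?thesis
  proof
    show "compact_space hull.mtopology"
      using compact_delone_hull[OF S flc] by (simp add: hull_topology_eq)
    show "continuous_map hull.mtopology hull.mtopology (shift v)" for v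
    proof -
      have "\<exists>k>0. \<forall>y. y \<in> delone_hull S \<and> delone_dist x y < k \<longrightarrow> shift v y \<in> U"
        if x: "x \<in> delone_hull S" and U: "openin hull.mtopology U" "shift v x \<in> U" for x U
      proof -
        obtain e where e: "0 < e" "hull.mball (shift v x) e \<subseteq> U"
          using U unfolding hull.openin_mtopology by blast
        obtain k where "0 < k" "\<And>A B. delone_dist A B < k \<Longrightarrow> delone_dist (shift v A) (shift v B) < e"
          using delone_dist_shift_less[OF e(1)] by metis
        then show ?thesis using e(2) shift_hull[OF S] x by (metis hull.in_mball subsetD)
      qed
      then show ?thesis
        unfolding hull.continuous_map_from_metric using shift_hull[OF S] by simp
    qed
  qed (simp_all add: shift_0 shift_shift repetitive_orbit_dense[OF S rep])
qed

section \<open>The maximal equicontinuous factor and invariant pseudometrics\<close>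

text \<open>Identifying points at \<open>\<rho>\<close>-distance \<open>0\<close> turns the hull into a compact metric space with an
  isometric action, hence into an equicontinuous factor, and the factor map factors through \<open>\<pi>\<close>.\<close>

lemma invariant_pseudometric_vanishes_on_fibres:
  fixes S :: "'a::euclidean_space set"
  assumes S: "delone_set S" and flc: "finite_local_complexity S"
    and max: "maximal_equicontinuous_factor S Y act \<pi>"
    and \<rho>: "invariant_pseudometric (delone_hull S) delone_dist shift \<rho>"
    and T1: "T1 \<in> delone_hull S" and T2: "T2 \<in> delone_hull S" and fibre: "\<pi> T1 = \<pi> T2"
  shows "\<rho> T1 T2 = 0"
proof -
  let ?H = "delone_hull S"
  interpret hull: Metric_space ?H delone_dist by (rule Metric_space_delone_hull)
  have refl: "\<rho> x x = 0" if "x \<in> ?H" for x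
    using \<rho> that unfolding invariant_pseudometric_def by blast
  have nonneg: "0 \<le> \<rho> x y" and commute: "\<rho> x y = \<rho> y x" if "x \<in> ?H" "y \<in> ?H" for x y
    using \<rho> that unfolding invariant_pseudometric_def by blast+
  have triangle: "\<rho> x z \<le> \<rho> x y + \<rho> y z" if "x \<in> ?H" "y \<in> ?H" "z \<in> ?H" for x y z
    using \<rho> that unfolding invariant_pseudometric_def by blast
  have invariant: "\<rho> (shift v x) (shift v y) = \<rho> x y" if "x \<in> ?H" "y \<in> ?H" for v x y
    using \<rho> that unfolding invariant_pseudometric_def by blast
  have cont: "\<exists>k>0. \<forall>y\<in>?H. delone_dist x y < k \<longrightarrow> \<rho> x y < e" if "x \<in> ?H" "0 < e" for x e
    using \<rho> that unfolding invariant_pseudometric_def by blast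
  note shift_H = shift_hull[OF S]
  \<comment> \<open>the factor is realised on a set of representatives, which are themselves points of the hull\<close>
  define rep where "rep x = (SOME y. y \<in> ?H \<and> \<rho> x y = 0)" for x
  have rep: "rep x \<in> ?H" "\<rho> x (rep x) = 0" if "x \<in> ?H" for x
    using someI[of "\<lambda>y. y \<in> ?H \<and> \<rho> x y = 0" x] that refl[OF that] by (auto simp: rep_def)
  have \<rho>_cong: "\<rho> x z = \<rho> y z" if "x \<in> ?H" "y \<in> ?H" "z \<in> ?H" "\<rho> x y = 0" for x y z
    using triangle[of x y z] triangle[of y x z] commute[of x y] that by simp
  have \<rho>_rep: "\<rho> (rep x) (rep y) = \<rho> x y" if "x \<in> ?H" "y \<in> ?H" for x y
    using \<rho>_cong[of x "rep x" "rep y"] \<rho>_cong[of y "rep y" x] commute rep that by metis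
  have rep_eq: "rep x = rep y" if "x \<in> ?H" "y \<in> ?H" "\<rho> x y = 0" for x y
    unfolding rep_def by (rule arg_cong[where f = Eps]) (use \<rho>_cong[of x y] that in auto)
  have rep_shift_rep: "rep (shift v (rep x)) = rep (shift v x)" if "x \<in> ?H" for v x
    using rep[OF that] that shift_H invariant[of x "rep x" v] by (metis rep_eq)
  have rep_fix: "rep y = y" if "y \<in> rep ` ?H" for y
    using that rep rep_eq commute by (metis image_iff)
  \<comment> \<open>\<^locale>\<open>Metric_space\<close> demands symmetry and positivity outside the carrier as well\<close>
  define \<sigma> where "\<sigma> x y = (if x \<in> ?H \<and> y \<in> ?H then \<rho> x y else 0)" for x y
  have \<sigma>_rep: "\<sigma> (rep x) (rep y) = \<rho> x y" if "x \<in> ?H" "y \<in> ?H" for x y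
    using that rep \<rho>_rep by (simp add: \<sigma>_def)
  interpret Z: Metric_space "rep ` ?H" \<sigma>
  proof
    show "0 \<le> \<sigma> x y" "\<sigma> x y = \<sigma> y x" for x y
      using nonneg commute by (auto simp: \<sigma>_def)
    show "\<sigma> x y = 0 \<longleftrightarrow> x = y" if x: "x \<in> rep ` ?H" and y: "y \<in> rep ` ?H" for x y
    proof -
      obtain a b where ab: "a \<in> ?H" "b \<in> ?H" "x = rep a" "y = rep b" using x y by blast
      have "\<sigma> x y = \<rho> a b" unfolding ab(3,4) by (rule \<sigma>_rep[OF ab(1,2)])
      moreover have "\<rho> a b = 0" if "rep a = rep b"
        using \<rho>_rep[OF ab(1,2)] refl[OF rep(1)[OF ab(2)]] that by simp
      ultimately show ?thesis using rep_eq[OF ab(1,2)] ab(3,4) by metis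
    qed
    show "\<sigma> x z \<le> \<sigma> x y + \<sigma> y z" if "x \<in> rep ` ?H" "y \<in> rep ` ?H" "z \<in> rep ` ?H" for x y z
      using that triangle rep(1) unfolding \<sigma>_def by auto
  qed
  define Z where "Z = metric (rep ` ?H, \<sigma>)"
  have Z_simps: "mspace Z = rep ` ?H" "mdist Z = \<sigma>" "mtopology_of Z = Z.mtopology"
    by (simp_all add: Z_def Z.mtopology_of)
  define actZ where "actZ v y = rep (shift v y)" for v :: 'a and y
  have actZ_rep: "actZ v (rep x) = rep (shift v x)" if "x \<in> ?H" for v x
    using rep_shift_rep[OF that] by (simp add: actZ_def)
  have cont_rep: "continuous_map hull.mtopology Z.mtopology rep"
    unfolding hull.metric_continuous_map[OF Z.Metric_space_axioms]
  proof (intro conjI ballI allI impI)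
    fix x and e :: real assume "x \<in> ?H" "0 < e"
    then obtain k where "0 < k" "\<forall>y\<in>?H. delone_dist x y < k \<longrightarrow> \<rho> x y < e"
      using cont by blast
    then show "\<exists>k>0. \<forall>y. y \<in> ?H \<and> delone_dist x y < k \<longrightarrow> \<sigma> (rep x) (rep y) < e"
      using \<open>x \<in> ?H\<close> \<sigma>_rep by (intro exI[of _ k]) simp
  qed auto
  have "equicontinuous_factor S Z actZ rep"
    unfolding equicontinuous_factor_def Z_simps hull_topology_eq
  proof (intro conjI allI ballI)
    have "compactin Z.mtopology (rep ` topspace hull.mtopology)"
      using image_compactin[OF _ cont_rep, of "topspace hull.mtopology"] compact_delone_hull[OF S flc]
      by (simp add: compact_space_def hull_topology_eq)
    then show "compact_space Z.mtopology" by (simp add: compact_space_def)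
    show "continuous_map hull.mtopology Z.mtopology rep" by (rule cont_rep)
    show "rep (shift v x) = actZ v (rep x)" if "x \<in> ?H" for v x
      using actZ_rep[OF that] by simp
    show "equicontinuous_action Z actZ"
      unfolding equicontinuous_action_def Z_simps
      by (auto simp: actZ_rep \<sigma>_rep shift_H invariant)
    show "flow_on Z actZ"
      unfolding flow_on_def Z_simps
    proof (intro conjI allI ballI)
      show "actZ 0 y = y" if "y \<in> rep ` ?H" for y
        using rep_fix[OF that] by (simp add: actZ_def shift_0)
      show "actZ (u + v) y = actZ u (actZ v y)" if "y \<in> rep ` ?H" for u v y
        using that by (auto simp: actZ_rep shift_H shift_shift)
      show "continuous_map (prod_topology euclidean Z.mtopology) Z.mtopology (\<lambda>(v, y). actZ v y)"
        unfolding Z.continuous_map_to_metric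
      proof (intro ballI allI impI)
        fix p :: "'a \<times> 'a set" and e :: real
        assume p: "p \<in> topspace (prod_topology euclidean Z.mtopology)" and "0 < e"
        then obtain v0 x0 where p_eq: "p = (v0, rep x0)" and x0: "x0 \<in> ?H"
          by (cases p) auto
        obtain k where k: "0 < k" "\<And>y. y \<in> ?H \<Longrightarrow> delone_dist (shift v0 x0) y < k \<Longrightarrow> \<rho> (shift v0 x0) y < e / 2"
          using cont[OF shift_H[OF x0], of "e / 2"] \<open>0 < e\<close> by (metis half_gt_zero)
        define U where "U = ball v0 k \<times> Z.mball (rep x0) (e / 2)"
        have "(case q of (v, y) \<Rightarrow> actZ v y) \<in> Z.mball (actZ v0 (rep x0)) e" if q: "q \<in> U" for q
        proof -
          obtain v x where q_eq: "q = (v, rep x)" and x: "x \<in> ?H"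
            using q by (auto simp: U_def)
          have "dist v0 v < k" "\<rho> x0 x < e / 2"
            using q x x0 by (auto simp: U_def q_eq \<sigma>_rep)
          moreover have "\<rho> (shift v0 x0) (shift v x0) < e / 2"
            using k(2)[OF shift_H[OF x0]] delone_dist_shift_shift_le[of v0 x0 v] \<open>dist v0 v < k\<close>
            by (simp add: dist_norm)
          ultimately have "\<rho> (shift v0 x0) (shift v x) < e"
            using triangle[of "shift v0 x0" "shift v x0" "shift v x"] invariant[OF x0 x, of v] shift_H x x0
            by simp
          then show ?thesis using x x0 shift_H by (simp add: q_eq actZ_rep \<sigma>_rep)
        qed
        moreover have "openin (prod_topology euclidean Z.mtopology) U"
          unfolding U_def openin_prod_Times_iff by simp
        moreover have "p \<in> U" using k(1) \<open>0 < e\<close> x0 rep by (simp add: U_def p_eq \<sigma>_rep refl)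
        ultimately show "\<exists>U. openin (prod_topology euclidean Z.mtopology) U \<and> p \<in> U \<and>
            (\<forall>q\<in>U. (case q of (v, y) \<Rightarrow> actZ v y) \<in> Z.mball (case p of (v, y) \<Rightarrow> actZ v y) e)"
          unfolding p_eq by auto
      qed
    qed
  qed simp
  then obtain h where "\<And>x. x \<in> ?H \<Longrightarrow> rep x = h (\<pi> x)"
    using maximal_equicontinuous_factor_universal[OF max] by metis
  then have "rep T1 = rep T2" using T1 T2 fibre by simp
  then show ?thesis using \<rho>_rep[OF T1 T2] refl rep(1)[OF T2] by simp
qed

section \<open>The canonical transversal\<close>

lemma in_Xi_iff:
  assumes "delone_set S"
  shows "T \<in> Xi S \<longleftrightarrow> T \<in> delone_hull S \<and> (\<forall>e>0. \<exists>x\<in>S. delone_dist T (shift x S) < e)"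
proof -
  interpret hull: Metric_space "delone_hull S" delone_dist by (rule Metric_space_delone_hull)
  show ?thesis
    unfolding Xi_def hull_topology_eq hull.metric_closure_of
    using shift_in_hull[OF assms] by auto
qed

lemma shift_in_Xi:
  assumes "delone_set S" "x \<in> S"
  shows "shift x S \<in> Xi S"
  using assms delone_set_shift[OF assms(1), of x] shift_in_hull[OF assms(1)]
  by (auto simp: in_Xi_iff intro!: bexI[of _ x])

text \<open>Sets close to one that contains \<open>0\<close> have a point close to \<open>0\<close>, and \<open>T\<close> is closed.\<close>

lemma zero_in_Xi:
  assumes S: "delone_set S" and T: "T \<in> Xi S"
  shows "0 \<in> T"
proof -
  have "closed T"
    using T S by (auto simp: in_Xi_iff in_delone_hull_iff delone_set_def uniform_discrete_imp_closed)
  moreover have "\<exists>q\<in>T. dist q 0 < e" if "0 < e" for e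
  proof -
    define k where "k = min 1 (e / 3)"
    have k: "0 < k" "k \<le> 1" "3 * k \<le> e" using that by (auto simp: k_def)
    obtain x where x: "x \<in> S" "delone_dist T (shift x S) < k"
      using T k(1) by (auto simp: in_Xi_iff[OF S])
    obtain u w where uw: "norm u \<le> k" "norm w \<le> k" "agree_on_ball (1 / k) (shift u T) (shift w (shift x S))"
      using delone_dist_less(2)[OF x(2) k(2)] unfolding delone_close_def by blast
    have "1 \<le> 1 / k" using k by simp
    then have "norm (- w) \<le> 1 / k" using uw(2) k(2) by simp
    then have "u - w \<in> T" using agree_on_ballD[OF uw(3), of "- w"] x(1) by (simp add: mem_shift)
    moreover have "dist (u - w) 0 < e"
      using uw k norm_triangle_ineq4[of u w] by simp
    ultimately show ?thesis by blast
  qed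
  ultimately show ?thesis using closure_approachable[of 0 T] by (simp add: closure_closed)
qed

text \<open>The small translations allowed in the metric of the hull are removed here: as \<open>0 \<in> T\<close>, a
  translate of \<open>S\<close> that is close to \<open>T\<close> has a point close to the origin.\<close>

lemma Xi_visit_near_point:
  assumes S: "delone_set S" and T: "T \<in> Xi S" and a: "delone_dist T (shift a S) < e" and "e \<le> 1"
  obtains p where "p \<in> S" "norm (p - a) \<le> 2 * e" "delone_dist T (shift p S) < 3 * e"
proof -
  have "0 < e" using delone_dist_less(1)[OF a \<open>e \<le> 1\<close>] .
  obtain u w where uw: "norm u \<le> e" "norm w \<le> e" "agree_on_ball (1 / e) (shift u T) (shift w (shift a S))"
    using delone_dist_less(2)[OF a \<open>e \<le> 1\<close>] unfolding delone_close_def by blast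
  define p where "p = a + w - u"
  have "1 \<le> 1 / e" using \<open>0 < e\<close> \<open>e \<le> 1\<close> by simp
  then have "norm (- u) \<le> 1 / e" using uw(1) \<open>e \<le> 1\<close> by simp
  then have "p \<in> S" using agree_on_ballD[OF uw(3), of "- u"] zero_in_Xi[OF S T]
    by (simp add: mem_shift p_def algebra_simps)
  moreover have d: "norm (p - a) \<le> 2 * e"
    using uw norm_triangle_ineq4[of w u] by (simp add: p_def)
  moreover have "delone_dist T (shift p S) < 3 * e"
  proof -
    have "delone_dist T (shift p S) \<le> delone_dist T (shift a S) + delone_dist (shift a S) (shift p S)"
      using T S by (intro delone.triangle) (auto simp: in_Xi_iff in_delone_hull_iff delone_set_shift)
    then show ?thesis
      using a d delone_dist_shift_shift_le[of a S p] by (simp add: norm_minus_commute)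
  qed
  ultimately show thesis by (rule that)
qed

lemma transversal_extension_uniformly_continuous:
  fixes S :: "'a::euclidean_space set"
  assumes S: "delone_set S" and flc: "finite_local_complexity S"
    and Ft: "transversal_extension S F Ft" and "0 < e"
  obtains k where "0 < k"
    "\<And>T1 T2. T1 \<in> Xi S \<Longrightarrow> T2 \<in> Xi S \<Longrightarrow> delone_dist T1 T2 < k \<Longrightarrow> norm (Ft T1 - Ft T2) < e"
proof -
  interpret hull: Metric_space "delone_hull S" delone_dist by (rule Metric_space_delone_hull)
  interpret Xi: Submetric "delone_hull S" delone_dist "Xi S"
    by unfold_locales (auto simp: in_Xi_iff[OF S])
  define m where "m = metric (Xi S, delone_dist)"
  have m: "mspace m = Xi S" "mdist m = delone_dist" "mtopology_of m = subtopology (hull_topology S) (Xi S)"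
    by (simp_all add: m_def Xi.sub.mtopology_of Xi.mtopology_submetric hull_topology_eq)
  have "compactin (hull_topology S) (Xi S)"
    unfolding Xi_def by (rule closedin_compact_space[OF compact_delone_hull[OF S flc]]) simp
  then have "compact_space (mtopology_of m)" by (simp add: m compact_space_subtopology)
  moreover have "continuous_map (mtopology_of m) (mtopology_of euclidean_metric) Ft"
    using Ft by (simp add: m transversal_extension_def)
  ultimately have "uniformly_continuous_map m euclidean_metric Ft"
    by (simp add: continuous_imp_uniformly_continuous_map)
  then have "\<exists>k>0. \<forall>x\<in>Xi S. \<forall>y\<in>Xi S. delone_dist y x < k \<longrightarrow> dist (Ft y) (Ft x) < e"
    using \<open>0 < e\<close> by (simp add: uniformly_continuous_map_def m)
  then show thesis using that by (auto simp: dist_norm)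
qed

section \<open>Meyer deformations are nonslip\<close>

theorem theorem1p4:
  fixes \<Lambda> :: "'a::euclidean_space set"
    and F :: "'a \<Rightarrow> 'a"
    and \<Omega>max :: "'y metric"
    and act :: "'a \<Rightarrow> 'y \<Rightarrow> 'y"
    and \<pi>max :: "'a set \<Rightarrow> 'y"
  assumes "meyer_set \<Lambda>"
    and "repetitive \<Lambda>"
    and "finite_local_complexity \<Lambda>"
    and "maximal_equicontinuous_factor \<Lambda> \<Omega>max act \<pi>max"
    and "shape_deformation_generator \<Lambda> F"
    and "weakly_pattern_equivariant \<Lambda> F"
    and "\<not> nonslip \<Lambda> \<pi>max F"
  shows "\<not> meyer_set (deformed_set \<Lambda> F)"
proof
  assume "meyer_set (deformed_set \<Lambda> F)"
  then have "uniform_discrete {x - y |x y. x \<in> deformed_set \<Lambda> F \<and> y \<in> deformed_set \<Lambda> F}"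
    by (simp add: meyer_set_def)
  then obtain r where r: "0 < r" "\<And>P Q. P \<in> {x - y |x y. x \<in> deformed_set \<Lambda> F \<and> y \<in> deformed_set \<Lambda> F} \<Longrightarrow>
      Q \<in> {x - y |x y. x \<in> deformed_set \<Lambda> F \<and> y \<in> deformed_set \<Lambda> F} \<Longrightarrow> dist P Q < r \<Longrightarrow> P = Q"
    unfolding uniform_discrete_def by blast
  have "uniform_discrete {x - y |x y. x \<in> \<Lambda> \<and> y \<in> \<Lambda>}"
    using assms(1) by (simp add: meyer_set_def)
  then obtain r0 where r0: "0 < r0" "\<And>P Q. P \<in> {x - y |x y. x \<in> \<Lambda> \<and> y \<in> \<Lambda>} \<Longrightarrow>
      Q \<in> {x - y |x y. x \<in> \<Lambda> \<and> y \<in> \<Lambda>} \<Longrightarrow> dist P Q < r0 \<Longrightarrow> P = Q"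
    unfolding uniform_discrete_def by blast
  have \<Lambda>: "delone_set \<Lambda>" using assms(1) by (simp add: meyer_set_def)
  interpret hull: minimal_abelian_action "delone_hull \<Lambda>" delone_dist shift
    by (rule minimal_abelian_action_hull[OF \<Lambda> assms(3,2)])
  obtain Ft where Ft: "transversal_extension \<Lambda> F Ft"
    using assms(6) by (auto simp: weakly_pattern_equivariant_def)
  have F_eq: "F x = Ft (shift x \<Lambda>)" if "x \<in> \<Lambda>" for x
    using Ft that by (auto simp: transversal_extension_def)
  \<comment> \<open>the failure of nonslip gives \<open>T1\<close>, \<open>T2\<close> in one fibre on which \<open>Ft\<close> differs, but by less than \<open>r / 2\<close>\<close>
  obtain k where k: "0 < k" "\<And>T1 T2. T1 \<in> Xi \<Lambda> \<Longrightarrow> T2 \<in> Xi \<Lambda> \<Longrightarrow> delone_dist T1 T2 < k \<Longrightarrow>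
      norm (Ft T1 - Ft T2) < r / 2"
    using transversal_extension_uniformly_continuous[OF \<Lambda> assms(3) Ft half_gt_zero[OF r(1)]] by metis
  obtain T1 T2 where T: "T1 \<in> Xi \<Lambda>" "T2 \<in> Xi \<Lambda>" "\<pi>max T1 = \<pi>max T2"
      "agree_on_ball (1 / (k / 2)) T1 T2" "Ft T1 \<noteq> Ft T2"
    using assms(7) Ft half_gt_zero[OF k(1)] unfolding nonslip_def by blast
  have hull: "T1 \<in> delone_hull \<Lambda>" "T2 \<in> delone_hull \<Lambda>" "\<Lambda> \<in> delone_hull \<Lambda>"
    using T \<Lambda> shift_in_hull[OF \<Lambda>, of 0] by (auto simp: in_Xi_iff shift_0)
  define c where "c = norm (Ft T1 - Ft T2)"
  have "delone_dist T1 T2 \<le> 1 / (1 / (k / 2))"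
    by (rule delone_dist_le_of_agree[OF _ T(4)]) (use k(1) in simp)
  then have "delone_dist T1 T2 < k" using k(1) by simp
  then have c: "0 < c" "c < r / 2" using k(2)[OF T(1,2)] T(5) by (auto simp: c_def)
  \<comment> \<open>four errors of \<open>c / 4\<close> cannot compensate the slip \<open>c\<close>, and together with it they stay below \<open>r\<close>\<close>
  obtain k' where k': "0 < k'" "\<And>T1 T2. T1 \<in> Xi \<Lambda> \<Longrightarrow> T2 \<in> Xi \<Lambda> \<Longrightarrow> delone_dist T1 T2 < k' \<Longrightarrow>
      norm (Ft T1 - Ft T2) < c / 4"
    using transversal_extension_uniformly_continuous[OF \<Lambda> assms(3) Ft, of "c / 4"] c(1) by auto
  \<comment> \<open>passing to points of \<open>\<Lambda>\<close> multiplies distances in the hull by \<open>3\<close>; four displacements of \<open>2e\<close> must add up to less than \<open>r0\<close>\<close>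
  define e where "e = min 1 (min (k' / 3) (r0 / 9))"
  have e: "0 < e" "e \<le> 1" "3 * e \<le> k'" "8 * e < r0" using k'(1) r0(1) by (auto simp: e_def)
  obtain a b u w where abuw: "delone_dist T1 (shift a \<Lambda>) < e" "delone_dist T2 (shift b \<Lambda>) < e"
      "delone_dist T2 (shift u \<Lambda>) < e" "delone_dist T2 (shift w \<Lambda>) < e" "a - w = b - u"
    using hull.regional_proximality[OF hull e(1)]
      invariant_pseudometric_vanishes_on_fibres[OF \<Lambda> assms(3,4) _ hull(1,2) T(3)] by metis
  have point: "\<exists>p\<in>\<Lambda>. norm (p - a) \<le> 2 * e \<and> norm (F p - Ft T) < c / 4"
    if T: "T \<in> Xi \<Lambda>" and a: "delone_dist T (shift a \<Lambda>) < e" for T a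
  proof -
    obtain p where p: "p \<in> \<Lambda>" "norm (p - a) \<le> 2 * e" "delone_dist T (shift p \<Lambda>) < 3 * e"
      using Xi_visit_near_point[OF \<Lambda> T a e(2)] .
    then have "norm (Ft T - Ft (shift p \<Lambda>)) < c / 4"
      using k'(2)[OF T shift_in_Xi[OF \<Lambda> p(1)]] e(3) by simp
    then show ?thesis using p F_eq[OF p(1)] by (auto simp: norm_minus_commute)
  qed
  obtain pa where pa: "pa \<in> \<Lambda>" "norm (pa - a) \<le> 2 * e" "norm (F pa - Ft T1) < c / 4"
    using point[OF T(1) abuw(1)] by blast
  obtain pb where pb: "pb \<in> \<Lambda>" "norm (pb - b) \<le> 2 * e" "norm (F pb - Ft T2) < c / 4"
    using point[OF T(2) abuw(2)] by blast
  obtain pu where pu: "pu \<in> \<Lambda>" "norm (pu - u) \<le> 2 * e" "norm (F pu - Ft T2) < c / 4"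
    using point[OF T(2) abuw(3)] by blast
  obtain pw where pw: "pw \<in> \<Lambda>" "norm (pw - w) \<le> 2 * e" "norm (F pw - Ft T2) < c / 4"
    using point[OF T(2) abuw(4)] by blast
  have four: "norm (x1 - x2 - (x3 - x4)) \<le> norm x1 + norm x2 + norm x3 + norm x4" for x1 x2 x3 x4 :: 'a
    using norm_triangle_ineq4[of "x1 - x2" "x3 - x4"] norm_triangle_ineq4[of x1 x2]
      norm_triangle_ineq4[of x3 x4] by linarith
  \<comment> \<open>in \<open>\<Lambda> - \<Lambda>\<close>, differences that are close are equal\<close>
  have split: "(pa - pw) - (pb - pu) = (pa - a) - (pw - w) - ((pb - b) - (pu - u))"
    using abuw(5) by (simp add: algebra_simps)
  have "dist (pa - pw) (pb - pu) \<le> 8 * e"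
    unfolding dist_norm split
    using four[of "pa - a" "pw - w" "pb - b" "pu - u"] pa(2) pb(2) pu(2) pw(2) by linarith
  then have same: "pa - pw = pb - pu"
    using r0(2)[of "pa - pw" "pb - pu"] pa(1) pb(1) pu(1) pw(1) e(4) by fastforce
  define g where "g = (F pa - F pw) - (F pb - F pu)"
  have g_split: "g - (Ft T1 - Ft T2) = (F pa - Ft T1) - (F pw - Ft T2) - ((F pb - Ft T2) - (F pu - Ft T2))"
    by (simp add: g_def)
  have g: "norm (g - (Ft T1 - Ft T2)) < c"
    unfolding g_split
    using four[of "F pa - Ft T1" "F pw - Ft T2" "F pb - Ft T2" "F pu - Ft T2"] pa(3) pb(3) pu(3) pw(3)
    by linarith
  define P where "P = (pa + F pa) - (pw + F pw)"
  define Q where "Q = (pb + F pb) - (pu + F pu)"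
  have PQ: "P - Q = g" using same by (simp add: P_def Q_def g_def algebra_simps)
  have "dist P Q < r"
    using norm_triangle_ineq2[of g "Ft T1 - Ft T2"] g c by (simp add: c_def dist_norm PQ)
  moreover have "P \<in> {x - y |x y. x \<in> deformed_set \<Lambda> F \<and> y \<in> deformed_set \<Lambda> F}"
      "Q \<in> {x - y |x y. x \<in> deformed_set \<Lambda> F \<and> y \<in> deformed_set \<Lambda> F}"
    unfolding P_def Q_def deformed_set_def using pa(1) pb(1) pu(1) pw(1) by blast+
  ultimately have "P = Q" by (intro r(2))
  then have "g = 0" using PQ by simp
  then show False using g by (simp add: c_def norm_minus_commute)
qed

end
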